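(* Let $\Psi=\{f_1,\dots,f_N\}$ be a system of contracting similitudes of $\mathbb{R}^n$ satisfying the strong separation condition, with self-similar set $E$ of diameter $|E|=1$ and similarity dimension $s$. Let $\tilde c=\tilde c_{\tilde k}$ for a fixed $\tilde k\ge1$ with $\tilde c_{\tilde k}>0$, and for $k\ge1$ let $$\tilde m_k=\max\{h_k(x,d):(x,d)\in A_k\times D_k\}.$$ Then $\tilde m_k\to P^s(E)$ as $k\to\infty$. Moreover, for every $k\ge1$ with $D_k\ne\emptyset$ and every pair $(\tilde x_k,\tilde d_k)\in A_k\times D_k$ with $\tilde m_k=h_k(\tilde x_k,\tilde d_k)$, if $\mu_k(B'(\tilde x_k,\tilde d_k))=\mu(B(\tilde x_k,\tilde d_k))$, then $P^s(E)\ge\tilde m_k$.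
   Context: Setting: $\Psi=\{f_1,\dots,f_N\}$, $N\ge 2$, is a system of contracting similitudes of $\mathbb{R}^n$ with ratios $r_1,\dots,r_N\in(0,1)$, i.e. $|f_i(x)-f_i(y)|=r_i|x-y|$. $E$ is the unique nonempty compact set with $E=\bigcup_{i=1}^N f_i(E)$. The strong separation condition (SSC) means $f_i(E)\cap f_j(E)=\emptyset$ for all $i\ne j$. Write $r_{\min}=\min_i r_i$, $r_{\max}=\max_i r_i$. The similarity dimension $s$ is the unique solution of $\sum_{i=1}^N r_i^s=1$. The natural measure $\mu$ is the unique Borel probability measure on $E$ with $\mu(f_{i_1}\circ\cdots\circ f_{i_k}(E))=(r_{i_1}\cdots r_{i_k})^s$ for all finite words $i_1\dots i_k$. $B(x,d)$ and $B'(x,d)$ are the closed and open Euclidean balls. Packing measure: for $A\subset\mathbb{R}^n$, $P^s_\delta(A)=\sup\sum_i|B_i|^s$, the supremum over all countable families of pairwise disjoint closed Euclidean balls $B_i$ centered at points of $A$ with diameters $|B_i|\le\delta$; $P^s_0(A)=\lim_{\delta\to0}P^s_\delta(A)$; and $P^s(A)=\inf\{\sum_{i=1}^\infty P_0^s(U_i): A\subset\bigcup_{i=1}^\infty U_i\}$. Algorithm objects: $A_1$ is the set of the $N$ fixed points of $f_1,\dots,f_N$, and $A_k=\bigcup_{i=1}^N f_i(A_{k-1})$ for $k\ge2$; $A_k$ has $N^k$ points. Each $x\in A_k$ has a unique word $\mathbf{i}_k(x)=i_1(x)\dots i_k(x)\in\{1,\dots,N\}^k$ such that $x=f_{i_1(x)}\circ\cdots\circ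 f_{i_k(x)}(y)$ for some $y\in A_1$ (then $y$ is the fixed point of $f_{i_k(x)}$). The discrete probability measure $\mu_k$ is supported on $A_k$ with $\mu_k(\{x\})=(r_{i_1(x)}\cdots r_{i_k(x)})^s$ for $x\in A_k$. Put $c_k=\min\{|x-y|:x,y\in A_k,\ i_1(x)\ne i_1(y)\}$ and $\tilde c_k=c_k-2r_{\max}^k$. For the fixed $\tilde c=\tilde c_{\tilde k}>0$, let $D_k$ be the set of all distances $|x-y|$ with $x,y\in A_k$ and $\tilde c\le|x-y|\le\frac{\tilde c}{r_{\min}}$. For $x\in A_k$ and $d>0$, $h_k(x,d)=\frac{(2d)^s}{\mu_k(B'(x,d))}$. Convention: $\tilde m_k=0$ if $D_k=\emptyset$. *)

theory Defs
  imports "HOL-Probability.Probability"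
begin

section \<open>Packing measure\<close>

(* The value may be infinite, so all packing quantities live in ennreal.
   A member of a packing determines its term of the sum, and disjoint nonempty balls are
   distinct, so a countable disjoint family may be given as a set of balls. *)
definition packings :: "real \<Rightarrow> (real ^ 'n) set \<Rightarrow> (real ^ 'n) set set set" where
  "packings \<delta> A = {\<B>. countable \<B> \<and> disjoint \<B> \<and>
     (\<forall>B\<in>\<B>. \<exists>x\<in>A. \<exists>\<rho>>0. B = cball x \<rho> \<and> diameter B \<le> \<delta>)}"

definition packing_premeasure_at :: "real \<Rightarrow> real \<Rightarrow> (real ^ 'n) set \<Rightarrow> ennreal" where
  "packing_premeasure_at s \<delta> A =
     (SUP \<B>\<in>packings \<delta> A. \<Sum>\<^sub>\<infinity>B\<in>\<B>. ennreal (diameter B powr s))"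

definition packing_premeasure :: "real \<Rightarrow> (real ^ 'n) set \<Rightarrow> ennreal" where
  "packing_premeasure s A = Lim (at_right 0) (\<lambda>\<delta>. packing_premeasure_at s \<delta> A)"

definition packing_measure :: "real \<Rightarrow> (real ^ 'n) set \<Rightarrow> ennreal" where
  "packing_measure s A =
     Inf {\<Sum>i. packing_premeasure s (U i) | U :: nat \<Rightarrow> (real ^ 'n) set. A \<subseteq> (\<Union>i. U i)}"

(* The limit exists, because the family is monotone in \<delta>. *)
lemma packing_premeasure_at_mono:
  assumes "\<delta> \<le> \<delta>'"
  shows "packing_premeasure_at s \<delta> A \<le> packing_premeasure_at s \<delta>' A"
  unfolding packing_premeasure_at_def
  by (rule SUP_subset_mono) (use assms in \<open>fastforce simp: packings_def\<close>)+

lemma packing_premeasure_tendsto: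
  "((\<lambda>\<delta>. packing_premeasure_at s \<delta> A) \<longlongrightarrow> packing_premeasure s A) (at_right 0)"
proof -
  let ?f = "\<lambda>\<delta>. packing_premeasure_at s \<delta> A"
  have "(?f \<longlongrightarrow> (INF \<delta>\<in>{0<..}. ?f \<delta>)) (at_right 0)"
  proof (rule decreasing_tendsto)
    show "\<forall>\<^sub>F \<delta> in at_right 0. (INF \<delta>\<in>{0<..}. ?f \<delta>) \<le> ?f \<delta>"
      by (auto simp: eventually_at_right_field intro!: exI[of _ 1] INF_lower)
  next
    fix y assume "(INF \<delta>\<in>{0<..}. ?f \<delta>) < y"
    then obtain \<delta>' where \<delta>': "\<delta>' > 0" "?f \<delta>' < y"
      by (auto simp: INF_less_iff)
    show "\<forall>\<^sub>F \<delta> in at_right 0. ?f \<delta> < y"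
      using \<delta>' packing_premeasure_at_mono[of _ \<delta>' s A]
      by (auto simp: eventually_at_right_field intro!: exI[of _ \<delta>'])
        (meson le_less_trans less_imp_le)
  qed
  then show ?thesis
    unfolding packing_premeasure_def
    by (metis tendsto_Lim trivial_limit_at_right_real)
qed

section \<open>Self-similar sets\<close>

definition similitudes :: "nat \<Rightarrow> (nat \<Rightarrow> real ^ 'n \<Rightarrow> real ^ 'n) \<Rightarrow> (nat \<Rightarrow> real) \<Rightarrow> bool" where
  "similitudes N f r \<longleftrightarrow>
     (\<forall>i\<in>{1..N}. 0 < r i \<and> r i < 1 \<and> (\<forall>x y. dist (f i x) (f i y) = r i * dist x y))"

definition self_similar_set :: "nat \<Rightarrow> (nat \<Rightarrow> real ^ 'n \<Rightarrow> real ^ 'n) \<Rightarrow> (real ^ 'n) set \<Rightarrow> bool" where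
  "self_similar_set N f E \<longleftrightarrow> compact E \<and> E \<noteq> {} \<and> E = (\<Union>i\<in>{1..N}. f i ` E)"

definition strong_separation :: "nat \<Rightarrow> (nat \<Rightarrow> real ^ 'n \<Rightarrow> real ^ 'n) \<Rightarrow> (real ^ 'n) set \<Rightarrow> bool" where
  "strong_separation N f E \<longleftrightarrow>
     (\<forall>i\<in>{1..N}. \<forall>j\<in>{1..N}. i \<noteq> j \<longrightarrow> f i ` E \<inter> f j ` E = {})"

definition similarity_dimension :: "nat \<Rightarrow> (nat \<Rightarrow> real) \<Rightarrow> real \<Rightarrow> bool" where
  "similarity_dimension N r s \<longleftrightarrow> (\<Sum>i=1..N. r i powr s) = 1"

definition r_min :: "nat \<Rightarrow> (nat \<Rightarrow> real) \<Rightarrow> real" where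
  "r_min N r = Min (r ` {1..N})"

definition r_max :: "nat \<Rightarrow> (nat \<Rightarrow> real) \<Rightarrow> real" where
  "r_max N r = Max (r ` {1..N})"

primrec word_map :: "(nat \<Rightarrow> 'a \<Rightarrow> 'a) \<Rightarrow> nat list \<Rightarrow> 'a \<Rightarrow> 'a" where
  "word_map f [] = id"
| "word_map f (i # w) = f i \<circ> word_map f w"

definition word_ratio :: "(nat \<Rightarrow> real) \<Rightarrow> nat list \<Rightarrow> real" where
  "word_ratio r w = prod_list (map r w)"

definition natural_measure ::
  "nat \<Rightarrow> (nat \<Rightarrow> real ^ 'n \<Rightarrow> real ^ 'n) \<Rightarrow> (nat \<Rightarrow> real) \<Rightarrow> real \<Rightarrow> (real ^ 'n) set \<Rightarrow>
   (real ^ 'n) measure \<Rightarrow> bool" where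
  "natural_measure N f r s E \<mu> \<longleftrightarrow>
     prob_space \<mu> \<and> sets \<mu> = sets borel \<and> measure \<mu> E = 1 \<and>
     (\<forall>w. set w \<subseteq> {1..N} \<longrightarrow> measure \<mu> (word_map f w ` E) = word_ratio r w powr s)"

section \<open>Discrete approximation\<close>

(* Only indices k \<ge> 1 are meaningful; the value at 0 is a dummy. *)
fun A_pts :: "nat \<Rightarrow> (nat \<Rightarrow> real ^ 'n \<Rightarrow> real ^ 'n) \<Rightarrow> nat \<Rightarrow> (real ^ 'n) set" where
  "A_pts N f 0 = {}"
| "A_pts N f (Suc 0) = {x. \<exists>i\<in>{1..N}. f i x = x}"
| "A_pts N f (Suc (Suc k)) = (\<Union>i\<in>{1..N}. f i ` A_pts N f (Suc k))"

(* Well-defined for x in A_pts N f k (k \<ge> 1) under strong separation. *)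
definition address :: "nat \<Rightarrow> (nat \<Rightarrow> real ^ 'n \<Rightarrow> real ^ 'n) \<Rightarrow> nat \<Rightarrow> real ^ 'n \<Rightarrow> nat list" where
  "address N f k x =
     (THE w. length w = k \<and> set w \<subseteq> {1..N} \<and> (\<exists>y\<in>A_pts N f 1. x = word_map f w y))"

(* Discrete measure on the whole space, so that every set, in particular every ball, is measurable. *)
definition mu_disc ::
  "nat \<Rightarrow> (nat \<Rightarrow> real ^ 'n \<Rightarrow> real ^ 'n) \<Rightarrow> (nat \<Rightarrow> real) \<Rightarrow> real \<Rightarrow> nat \<Rightarrow> (real ^ 'n) measure" where
  "mu_disc N f r s k = point_measure UNIV
     (\<lambda>x. if x \<in> A_pts N f k then ennreal (word_ratio r (address N f k x) powr s) else 0)"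

definition c_gap :: "nat \<Rightarrow> (nat \<Rightarrow> real ^ 'n \<Rightarrow> real ^ 'n) \<Rightarrow> nat \<Rightarrow> real" where
  "c_gap N f k = Min {dist x y | x y. x \<in> A_pts N f k \<and> y \<in> A_pts N f k \<and>
     hd (address N f k x) \<noteq> hd (address N f k y)}"

definition c_tilde ::
  "nat \<Rightarrow> (nat \<Rightarrow> real ^ 'n \<Rightarrow> real ^ 'n) \<Rightarrow> (nat \<Rightarrow> real) \<Rightarrow> nat \<Rightarrow> real" where
  "c_tilde N f r k = c_gap N f k - 2 * r_max N r ^ k"

definition D_dists ::
  "nat \<Rightarrow> (nat \<Rightarrow> real ^ 'n \<Rightarrow> real ^ 'n) \<Rightarrow> (nat \<Rightarrow> real) \<Rightarrow> real \<Rightarrow> nat \<Rightarrow> real set" where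
  "D_dists N f r c k = {dist x y | x y. x \<in> A_pts N f k \<and> y \<in> A_pts N f k \<and>
     c \<le> dist x y \<and> dist x y \<le> c / r_min N r}"

definition h_disc ::
  "nat \<Rightarrow> (nat \<Rightarrow> real ^ 'n \<Rightarrow> real ^ 'n) \<Rightarrow> (nat \<Rightarrow> real) \<Rightarrow> real \<Rightarrow> nat \<Rightarrow> real ^ 'n \<Rightarrow> real \<Rightarrow> real" where
  "h_disc N f r s k x d = (2 * d) powr s / measure (mu_disc N f r s k) (ball x d)"

definition m_tilde ::
  "nat \<Rightarrow> (nat \<Rightarrow> real ^ 'n \<Rightarrow> real ^ 'n) \<Rightarrow> (nat \<Rightarrow> real) \<Rightarrow> real \<Rightarrow> real \<Rightarrow> nat \<Rightarrow> real" where
  "m_tilde N f r s c k =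
     (if D_dists N f r c k = {} then 0
      else Max ((\<lambda>(x, d). h_disc N f r s k x d) ` (A_pts N f k \<times> D_dists N f r c k)))"

end

theory Submission imports Defs begin

text \<open>
  Let \<open>h x d = (2 d)\<^sup>s / \<mu> (ball x d)\<close> and let \<open>hsup\<close> be its supremum over \<open>x \<in> E\<close> and \<open>c \<le> d \<le> c / rmin\<close>.
  As \<open>c\<close> is at most the distance between different first level pieces, \<open>h (f i x) (r i * d) = h x d\<close> whenever
  \<open>r i * d \<le> c\<close>, so that \<open>hsup\<close> bounds \<open>h\<close> at all radii up to \<open>c / rmin\<close>.

  The packing measure of \<open>E\<close> equals \<open>hsup\<close>. The upper bound is immediate. For the lower bound, a ball with almost
  maximal \<open>h\<close> together with scaled copies of an almost optimal finite packing in the uncovered cylinders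
  shows that finite packings of \<open>E\<close> have sums arbitrarily close to \<open>hsup\<close>. Such a packing can be copied into
  almost all small cylinders that meet a given set \<open>U\<close>, with centres moved into \<open>U\<close>, whence the
  packing premeasure of \<open>U\<close> is at least \<open>hsup * \<mu> (closure (U \<inter> E))\<close>.

  Since \<open>\<mu>\<^sub>k\<close> moves mass by at most \<open>rmax\<^sup>k\<close>, the discrete maxima are asymptotically at most \<open>hsup\<close>. Conversely, near
  an almost optimal \<open>(x, d)\<close> there are points of \<open>A\<^sub>k\<close> at distance about \<open>d\<close>: otherwise enlarging the ball
  to radius \<open>c / rmin\<close> would not increase its measure and \<open>h\<close> would exceed \<open>hsup\<close>.
\<close>

section \<open>Packing premeasures\<close>

lemma packing_premeasure_le:
  assumes "\<delta> > 0" shows "packing_premeasure s A \<le> packing_premeasure_at s \<delta> A"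
proof (rule tendsto_upperbound[OF packing_premeasure_tendsto])
  show "\<forall>\<^sub>F \<delta>' in at_right 0. packing_premeasure_at s \<delta>' A \<le> packing_premeasure_at s \<delta> A"
    unfolding eventually_at_right_field
    using assms packing_premeasure_at_mono[of _ \<delta> s A] less_imp_le by blast
qed simp

lemma le_packing_premeasure:
  assumes "\<And>\<delta>. \<delta> > 0 \<Longrightarrow> K \<le> packing_premeasure_at s \<delta> A"
  shows "K \<le> packing_premeasure s A"
proof (rule tendsto_lowerbound[OF packing_premeasure_tendsto])
  show "\<forall>\<^sub>F \<delta> in at_right 0. K \<le> packing_premeasure_at s \<delta> A"
    using assms by (auto simp: eventually_at_right_field intro!: exI[of _ 1])
qed simp

lemma packing_premeasure_empty: "packing_premeasure s ({} :: (real ^ 'n) set) = 0"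
proof -
  have "packings 1 ({} :: (real ^ 'n) set) = {{}}"
    by (auto simp: packings_def)
  then have "packing_premeasure_at s 1 ({} :: (real ^ 'n) set) = 0"
    unfolding packing_premeasure_at_def by simp
  then show ?thesis using packing_premeasure_le[of 1 s "{} :: (real ^ 'n) set"] by simp
qed

lemma packing_measure_le_premeasure: "packing_measure s A \<le> packing_premeasure s A"
proof -
  define U where "U i = (if i = 0 then A else {})" for i :: nat
  have "(\<lambda>i. packing_premeasure s (U i)) sums (\<Sum>i\<in>{0}. packing_premeasure s (U i))"
    by (rule sums_finite) (auto simp: U_def packing_premeasure_empty)
  then have "(\<Sum>i. packing_premeasure s (U i)) = packing_premeasure s A"
    by (simp add: sums_iff U_def)
  moreover have "A \<subseteq> (\<Union>i. U i)" by (auto simp: U_def)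
  ultimately show ?thesis
    unfolding packing_measure_def by (metis (mono_tags, lifting) Inf_lower mem_Collect_eq)
qed

text \<open>Later packings are constructed as indexed families of centres and radii. The strict
  inequality makes the closed balls disjoint; being nonempty they are then distinct, so the family
  and the set of its balls have the same sum.\<close>

lemma finite_family_le_packing_premeasure_at:
  fixes X :: "'i \<Rightarrow> real ^ 'n" and R :: "'i \<Rightarrow> real"
  assumes "finite I"
    and "\<And>i. i \<in> I \<Longrightarrow> X i \<in> A \<and> 0 < R i \<and> 2 * R i \<le> \<delta>"
    and "\<And>i j. i \<in> I \<Longrightarrow> j \<in> I \<Longrightarrow> i \<noteq> j \<Longrightarrow> R i + R j < dist (X i) (X j)"
  shows "ennreal (\<Sum>i\<in>I. (2 * R i) powr s) \<le> packing_premeasure_at s \<delta> A"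
proof -
  let ?B = "\<lambda>i. cball (X i) (R i)"
  have disj: "?B i \<inter> ?B j = {}" if "i \<in> I" "j \<in> I" "i \<noteq> j" for i j
    using assms(3)[OF that] by (intro disjoint_cballI) auto
  have inj: "inj_on ?B I"
  proof (rule inj_onI, rule ccontr)
    fix i j assume *: "i \<in> I" "j \<in> I" "?B i = ?B j" "i \<noteq> j"
    then have "X i \<in> ?B i \<inter> ?B j" using assms(2)[OF *(1)] by auto
    then show False using disj[OF *(1,2,4)] by blast
  qed
  have "?B ` I \<in> packings \<delta> A"
    unfolding packings_def
  proof (intro CollectI conjI ballI)
    show "countable (?B ` I)" using assms(1) by (simp add: uncountable_infinite countable_finite)
    show "disjoint (?B ` I)" using disj by (fastforce simp: disjoint_def pairwise_def disjnt_def)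
    fix B assume "B \<in> ?B ` I"
    then obtain i where "i \<in> I" "B = ?B i" by blast
    then show "\<exists>x\<in>A. \<exists>\<rho>>0. B = cball x \<rho> \<and> diameter B \<le> \<delta>" using assms(2)[of i] by auto
  qed
  then have "(\<Sum>\<^sub>\<infinity>B\<in>?B ` I. ennreal (diameter B powr s)) \<le> packing_premeasure_at s \<delta> A"
    unfolding packing_premeasure_at_def by (rule SUP_upper)
  also have "(\<Sum>\<^sub>\<infinity>B\<in>?B ` I. ennreal (diameter B powr s)) = (\<Sum>i\<in>I. ennreal (diameter (?B i) powr s))"
    using assms(1) inj by (simp add: sum.reindex)
  also have "\<dots> = (\<Sum>i\<in>I. ennreal ((2 * R i) powr s))"
    using assms(2) by (intro sum.cong) (fastforce dest: order.asym)+
  also have "\<dots> = ennreal (\<Sum>i\<in>I. (2 * R i) powr s)"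
    by (intro sum_ennreal) auto
  finally show ?thesis .
qed

text \<open>Mass distribution argument: disjoint balls have total mass at most 1, and the sum over a
  packing is controlled by its finite partial sums.\<close>

lemma packing_premeasure_at_le:
  fixes A :: "(real ^ 'n) set"
  assumes "prob_space M" and sets: "sets M = sets borel" and "K \<ge> 0"
    and le: "\<And>x \<rho>. x \<in> A \<Longrightarrow> 0 < \<rho> \<Longrightarrow> 2 * \<rho> \<le> \<delta> \<Longrightarrow> (2 * \<rho>) powr s \<le> K * measure M (cball x \<rho>)"
  shows "packing_premeasure_at s \<delta> A \<le> ennreal K"
  unfolding packing_premeasure_at_def
proof (rule SUP_least)
  interpret prob_space M by fact
  fix \<B> assume \<B>: "\<B> \<in> packings \<delta> A"
  show "(\<Sum>\<^sub>\<infinity>B\<in>\<B>. ennreal (diameter B powr s)) \<le> ennreal K"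
  proof (rule infsum_le_finite_sums)
    fix F assume F: "finite F" "F \<subseteq> \<B>"
    have ball: "B \<in> sets M \<and> diameter B powr s \<le> K * measure M B" if BF: "B \<in> F" for B
    proof -
      obtain x \<rho> where x: "x \<in> A" "\<rho> > 0" "B = cball x \<rho>" "diameter B \<le> \<delta>"
        using \<B> subsetD[OF F(2) BF] by (auto simp: packings_def)
      then have "diameter B = 2 * \<rho>" by simp
      then show ?thesis using le[OF x(1,2)] x(3,4) sets by (metis borel_closed closed_cball)
    qed
    have "(\<Sum>B\<in>F. diameter B powr s) \<le> (\<Sum>B\<in>F. K * measure M B)"
      using ball by (intro sum_mono) auto
    also have "\<dots> = K * (\<Sum>B\<in>F. measure M B)" by (simp add: sum_distrib_left)
    also have "(\<Sum>B\<in>F. measure M B) = measure M (\<Union>B\<in>F. B)"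
    proof (rule finite_measure_finite_Union[symmetric])
      show "disjoint_family_on (\<lambda>B. B) F"
        using \<B> F(2) unfolding packings_def disjoint_def disjoint_family_on_def by blast
    qed (use F ball in auto)
    also have "K * measure M (\<Union>B\<in>F. B) \<le> K" using assms(3) prob_le_1 by (simp add: mult_left_le)
    finally have "ennreal (\<Sum>B\<in>F. diameter B powr s) \<le> ennreal K" by (rule ennreal_leI)
    then show "(\<Sum>B\<in>F. ennreal (diameter B powr s)) \<le> ennreal K"
      by (subst sum_ennreal) auto
  qed (rule nonneg_summable_on_complete, simp)
qed

section \<open>Cylinders of a self-similar set\<close>

locale self_similar_system =
  fixes N :: nat
    and f :: "nat \<Rightarrow> real ^ 'n \<Rightarrow> real ^ 'n"
    and r :: "nat \<Rightarrow> real"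
    and s :: real
    and E :: "(real ^ 'n) set"
    and \<mu> :: "(real ^ 'n) measure"
  assumes N_ge_2: "N \<ge> 2"
    and similitudes: "similitudes N f r"
    and self_similar: "self_similar_set N f E"
    and separation: "strong_separation N f E"
    and diameter_E: "diameter E = 1"
    and dimension: "similarity_dimension N r s"
    and natural: "natural_measure N f r s E \<mu>"
begin

definition W :: "nat \<Rightarrow> nat list set" where
  "W k = {w. set w \<subseteq> {1..N} \<and> length w = k}"

abbreviation ratio :: "nat list \<Rightarrow> real" where
  "ratio \<equiv> word_ratio r"

text \<open>The natural measure of the cylinder of \<open>w\<close>, as \<open>measure_cyl\<close>
  states below.\<close>

definition mass :: "nat list \<Rightarrow> real" where
  "mass w = ratio w powr s"

definition cyl :: "nat list \<Rightarrow> (real ^ 'n) set" where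
  "cyl w = word_map f w ` E"

abbreviation rmin :: real where "rmin \<equiv> r_min N r"
abbreviation rmax :: real where "rmax \<equiv> r_max N r"

section \<open>Contraction ratios and the similarity dimension\<close>

lemma r_pos: "i \<in> {1..N} \<Longrightarrow> 0 < r i"
  and r_less_1: "i \<in> {1..N} \<Longrightarrow> r i < 1"
  and dist_f: "i \<in> {1..N} \<Longrightarrow> dist (f i x) (f i y) = r i * dist x y"
  using similitudes by (auto simp: similitudes_def)

lemma rmin_le: "i \<in> {1..N} \<Longrightarrow> rmin \<le> r i"
  and le_rmax: "i \<in> {1..N} \<Longrightarrow> r i \<le> rmax"
  by (auto simp: r_min_def r_max_def)

lemma rmin_attained: obtains i where "i \<in> {1..N}" "r i = rmin"
proof -
  have "rmin \<in> r ` {1..N}"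
    unfolding r_min_def using N_ge_2 by (intro Min_in) auto
  then show ?thesis using that by auto
qed

lemma rmax_attained: obtains i where "i \<in> {1..N}" "r i = rmax"
proof -
  have "rmax \<in> r ` {1..N}"
    unfolding r_max_def using N_ge_2 by (intro Max_in) auto
  then show ?thesis using that by auto
qed

lemma rmin_pos: "0 < rmin" and rmin_less_1: "rmin < 1"
  using rmin_attained r_pos r_less_1 by metis+

lemma rmax_pos: "0 < rmax" and rmax_less_1: "rmax < 1"
  using rmax_attained r_pos r_less_1 by metis+

lemma rmax_power_tendsto: "(\<lambda>k. rmax ^ k) \<longlonglongrightarrow> 0"
  using rmax_pos rmax_less_1 by (intro LIMSEQ_power_zero) auto

text \<open>For a nonpositive exponent every term of the dimension equation is at least 1, and there
  are at least two terms.\<close>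

lemma s_pos: "0 < s"
proof (rule ccontr)
  assume "\<not> 0 < s"
  then have "1 \<le> r i powr s" if "i \<in> {1..N}" for i
    using r_pos[OF that] r_less_1[OF that] powr_mono_both'[of s 0 "r i" "r i"]
      powr_mono'[of s 0 "r i"] by simp
  then have "(\<Sum>i=1..N. 1::real) \<le> (\<Sum>i=1..N. r i powr s)"
    by (intro sum_mono) auto
  then show False using dimension N_ge_2 by (simp add: similarity_dimension_def)
qed

lemma compact_E: "compact E" and E_nonempty: "E \<noteq> {}" and E_eq: "E = (\<Union>i\<in>{1..N}. f i ` E)"
  using self_similar unfolding self_similar_set_def by blast+

lemma f_in_E: "i \<in> {1..N} \<Longrightarrow> x \<in> E \<Longrightarrow> f i x \<in> E"
  using E_eq by blast

lemma E_cases: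
  assumes "x \<in> E" obtains i y where "i \<in> {1..N}" "y \<in> E" "x = f i y"
  using assms E_eq by blast

lemma dist_E: "x \<in> E \<Longrightarrow> y \<in> E \<Longrightarrow> dist x y \<le> 1"
  using diameter_bounded_bound[OF compact_imp_bounded[OF compact_E]] diameter_E by metis

section \<open>Words and their ratios\<close>

lemma word_ratio_simps [simp]:
  "ratio [] = 1" "ratio (i # w) = r i * ratio w" "ratio (u @ v) = ratio u * ratio v"
  by (auto simp: word_ratio_def)

lemma ratio_pos: "set w \<subseteq> {1..N} \<Longrightarrow> 0 < ratio w"
  by (induction w) (auto simp: r_pos)

lemma mass_pos: "set w \<subseteq> {1..N} \<Longrightarrow> 0 < mass w"
  using ratio_pos[of w] by (simp add: mass_def)

lemma mass_Cons: "set (i # w) \<subseteq> {1..N} \<Longrightarrow> mass (i # w) = r i powr s * mass w"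
  using ratio_pos[of w] r_pos[of i] by (simp add: mass_def powr_mult)

lemma mass_append: "set (u @ v) \<subseteq> {1..N} \<Longrightarrow> mass (u @ v) = mass u * mass v"
  using ratio_pos[of u] ratio_pos[of v] by (simp add: mass_def powr_mult)

lemma WD: "w \<in> W k \<Longrightarrow> set w \<subseteq> {1..N}" "w \<in> W k \<Longrightarrow> length w = k"
  by (auto simp: W_def)

lemma W_Cons [simp]: "i # w \<in> W (Suc k) \<longleftrightarrow> i \<in> {1..N} \<and> w \<in> W k"
  by (auto simp: W_def)

lemma W_0 [simp]: "W 0 = {[]}"
  by (auto simp: W_def)

lemma W_Suc_cases:
  assumes "w \<in> W (Suc k)" obtains i v where "w = i # v" "i \<in> {1..N}" "v \<in> W k"
  using assms by (cases w) (auto simp: W_def)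

lemma W_append: "u \<in> W k \<Longrightarrow> v \<in> W l \<Longrightarrow> u @ v \<in> W (k + l)"
  by (auto simp: W_def)

lemma W_append_cases:
  assumes "w \<in> W (k + l)" obtains u v where "w = u @ v" "u \<in> W k" "v \<in> W l"
proof
  show "w = take k w @ drop k w" by simp
  show "take k w \<in> W k" "drop k w \<in> W l"
    using assms set_take_subset[of k w] set_drop_subset[of k w] by (auto simp: W_def)
qed

lemma finite_W [simp]: "finite (W k)"
  unfolding W_def by (rule finite_lists_length_eq) simp

lemma ratio_le: "w \<in> W k \<Longrightarrow> ratio w \<le> rmax ^ k"
proof (induction k arbitrary: w)
  case (Suc k)
  then obtain i v where w: "w = i # v" "i \<in> {1..N}" "v \<in> W k" by (elim W_Suc_cases)
  show ?case
    using mult_mono[OF le_rmax[OF w(2)] Suc.IH[OF w(3)]] ratio_pos[OF WD(1)[OF w(3)]] rmax_pos w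
    by simp
qed simp

lemma ratio_ge: "w \<in> W k \<Longrightarrow> rmin ^ k \<le> ratio w"
proof (induction k arbitrary: w)
  case (Suc k)
  then obtain i v where w: "w = i # v" "i \<in> {1..N}" "v \<in> W k" by (elim W_Suc_cases)
  show ?case
    using mult_mono[OF rmin_le[OF w(2)] Suc.IH[OF w(3)]] r_pos[OF w(2)] rmin_pos w
    by simp
qed simp

lemma ratio_le_1: "w \<in> W k \<Longrightarrow> ratio w \<le> 1"
  using ratio_le[of w k] rmax_pos rmax_less_1 power_le_one[of rmax k] by simp

lemma mass_ge: "w \<in> W k \<Longrightarrow> (rmin ^ k) powr s \<le> mass w"
  unfolding mass_def using ratio_ge[of w k] rmin_pos s_pos by (intro powr_mono2) auto

lemma word_map_append: "word_map f (u @ v) x = word_map f u (word_map f v x)"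
  by (induction u) auto

lemma dist_word_map:
  "set w \<subseteq> {1..N} \<Longrightarrow> dist (word_map f w x) (word_map f w y) = ratio w * dist x y"
  by (induction w) (auto simp: dist_f)

lemma word_map_in_E: "set w \<subseteq> {1..N} \<Longrightarrow> x \<in> E \<Longrightarrow> word_map f w x \<in> E"
  by (induction w) (auto simp: f_in_E)

section \<open>Cylinder sets\<close>

lemma cyl_Nil [simp]: "cyl [] = E"
  by (simp add: cyl_def)

lemma cyl_Cons: "cyl (i # w) = f i ` cyl w"
  by (auto simp: cyl_def)

lemma cyl_append: "cyl (u @ v) = word_map f u ` cyl v"
  by (auto simp: cyl_def word_map_append image_iff)

lemma cyl_subset_E: "set w \<subseteq> {1..N} \<Longrightarrow> cyl w \<subseteq> E"
  by (auto simp: cyl_def word_map_in_E)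

lemma cyl_append_subset: "set v \<subseteq> {1..N} \<Longrightarrow> cyl (u @ v) \<subseteq> cyl u"
  using cyl_subset_E[of v] by (auto simp: cyl_append cyl_def[of u])

lemma cyl_nonempty: "cyl w \<noteq> {}"
  using E_nonempty by (simp add: cyl_def)

lemma E_cyl_cases: "x \<in> E \<Longrightarrow> \<exists>w\<in>W k. x \<in> cyl w"
proof (induction k arbitrary: x)
  case (Suc k)
  obtain i y where i: "i \<in> {1..N}" "y \<in> E" "x = f i y" using Suc.prems by (rule E_cases)
  obtain w where "w \<in> W k" "y \<in> cyl w" using Suc.IH[OF i(2)] by blast
  with i show ?case by (intro bexI[of _ "i # w"]) (auto simp: cyl_Cons)
qed simp

lemma cyl_cyl_cases: "x \<in> cyl u \<Longrightarrow> \<exists>v\<in>W l. x \<in> cyl (u @ v)"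
  using E_cyl_cases by (fastforce simp: cyl_append cyl_def[of u])

lemma f_inj: "i \<in> {1..N} \<Longrightarrow> f i x = f i y \<Longrightarrow> x = y"
  using dist_f[of i x y] r_pos[of i] by simp

lemma cyl_disjoint: "w \<in> W k \<Longrightarrow> w' \<in> W k \<Longrightarrow> w \<noteq> w' \<Longrightarrow> cyl w \<inter> cyl w' = {}"
proof (induction k arbitrary: w w')
  case (Suc k)
  obtain i v where w: "w = i # v" "i \<in> {1..N}" "v \<in> W k" using Suc.prems(1) by (elim W_Suc_cases)
  obtain j u where w': "w' = j # u" "j \<in> {1..N}" "u \<in> W k" using Suc.prems(2) by (elim W_Suc_cases)
  show ?case
  proof (cases "i = j")
    case True
    then have "cyl v \<inter> cyl u = {}" using Suc.prems(3) Suc.IH[OF w(3) w'(3)] w w' by simp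
    then show ?thesis using True w w' f_inj by (fastforce simp: cyl_Cons)
  next
    case False
    then have "f i ` E \<inter> f j ` E = {}"
      using separation w(2) w'(2) unfolding strong_separation_def by blast
    then show ?thesis
      using cyl_subset_E[OF WD(1)[OF w(3)]] cyl_subset_E[OF WD(1)[OF w'(3)]] w w'
      by (fastforce simp: cyl_Cons)
  qed
qed simp

text \<open>Here the normalisation of the diameter of \<open>E\<close> to 1 enters: a cylinder has
  diameter at most its ratio.\<close>

lemma dist_cyl:
  assumes "w \<in> W k" "x \<in> cyl w" "y \<in> cyl w"
  shows "dist x y \<le> rmax ^ k"
proof -
  obtain x' y' where "x' \<in> E" "y' \<in> E" "x = word_map f w x'" "y = word_map f w y'"
    using assms by (auto simp: cyl_def)
  then have "dist x y \<le> ratio w"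
    using dist_word_map[OF WD(1)[OF assms(1)]] dist_E[of x' y'] ratio_pos[OF WD(1)[OF assms(1)]]
    by (simp add: mult_left_le)
  then show ?thesis using ratio_le[OF assms(1)] by simp
qed

lemma compact_cyl:
  assumes "set w \<subseteq> {1..N}" shows "compact (cyl w)"
proof -
  have "lipschitz_on (ratio w) E (word_map f w)"
    using assms dist_word_map ratio_pos[of w] by (auto simp: lipschitz_on_def)
  then show ?thesis
    unfolding cyl_def using compact_E lipschitz_on_continuous_on compact_continuous_image by blast
qed

section \<open>The natural measure on cylinders\<close>

lemma prob_mu: "prob_space \<mu>" and sets_mu [measurable_cong]: "sets \<mu> = sets borel"
  and measure_E: "measure \<mu> E = 1"
  and measure_cyl: "set w \<subseteq> {1..N} \<Longrightarrow> measure \<mu> (cyl w) = mass w"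
  using natural by (auto simp: natural_measure_def cyl_def mass_def)

sublocale mu: prob_space \<mu> by (rule prob_mu)

lemma sets_closed: "closed A \<Longrightarrow> A \<in> sets \<mu>" and sets_open: "open A \<Longrightarrow> A \<in> sets \<mu>"
  by (simp_all add: sets_mu)

lemma sets_E: "E \<in> sets \<mu>"
  using compact_E by (intro sets_closed compact_imp_closed)

lemma sets_cyl: "set w \<subseteq> {1..N} \<Longrightarrow> cyl w \<in> sets \<mu>"
  using compact_cyl by (intro sets_closed compact_imp_closed)

lemma measure_UN_cyl:
  assumes "V \<subseteq> W k"
  shows "measure \<mu> (\<Union>w\<in>V. cyl w) = (\<Sum>w\<in>V. mass w)"
proof -
  have "measure \<mu> (\<Union>w\<in>V. cyl w) = (\<Sum>w\<in>V. measure \<mu> (cyl w))"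
  proof (rule mu.finite_measure_finite_Union)
    show "finite V" using assms finite_subset finite_W by blast
    show "cyl ` V \<subseteq> sets \<mu>" using assms sets_cyl WD(1) by blast
    show "disjoint_family_on cyl V"
      using assms cyl_disjoint unfolding disjoint_family_on_def by blast
  qed
  also have "\<dots> = (\<Sum>w\<in>V. mass w)"
    using assms WD(1) measure_cyl by (intro sum.cong) auto
  finally show ?thesis .
qed

lemma measure_Int_E:
  assumes "A \<in> sets \<mu>" shows "measure \<mu> (A \<inter> E) = measure \<mu> A"
proof -
  have "AE x in \<mu>. x \<in> E" using measure_E sets_E by (subst mu.prob_eq_1[symmetric]) auto
  then have "AE x in \<mu>. x \<in> A \<inter> E \<longleftrightarrow> x \<in> A" by eventually_elim auto
  then show ?thesis using assms sets_E by (intro measure_eq_AE) auto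
qed

lemma sum_mass_le_measure:
  assumes "A \<in> sets \<mu>" "V \<subseteq> W k" "\<And>w. w \<in> V \<Longrightarrow> cyl w \<subseteq> A"
  shows "(\<Sum>w\<in>V. mass w) \<le> measure \<mu> A"
  using assms unfolding measure_UN_cyl[OF assms(2), symmetric]
  by (intro mu.finite_measure_mono) auto

lemma measure_le_sum_mass:
  assumes "A \<in> sets \<mu>" "V \<subseteq> W k" "\<And>w. w \<in> W k \<Longrightarrow> cyl w \<inter> A \<noteq> {} \<Longrightarrow> w \<in> V"
  shows "measure \<mu> A \<le> (\<Sum>w\<in>V. mass w)"
proof -
  have fin: "finite V" using assms(2) finite_subset finite_W by blast
  have "measure \<mu> A = measure \<mu> (A \<inter> E)" using measure_Int_E[OF assms(1)] by simp
  also have "\<dots> \<le> measure \<mu> (\<Union>w\<in>V. cyl w)"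
  proof (rule mu.finite_measure_mono)
    show "A \<inter> E \<subseteq> (\<Union>w\<in>V. cyl w)" using E_cyl_cases[of _ k] assms(3) by blast
    show "(\<Union>w\<in>V. cyl w) \<in> sets \<mu>"
      using fin assms(2) sets_cyl WD(1) by (intro sets.finite_UN) auto
  qed
  finally show ?thesis using measure_UN_cyl[OF assms(2)] by simp
qed

lemma sum_mass_W: "(\<Sum>w\<in>W k. mass w) = 1"
proof -
  have "(\<Union>w\<in>W k. cyl w) = E"
    using E_cyl_cases[of _ k] cyl_subset_E WD(1) by blast
  then show ?thesis using measure_UN_cyl[of "W k" k] measure_E by simp
qed

text \<open>Cylinders shrink uniformly, so every point of \<open>G \<inter> E\<close> eventually has
  its cylinder inside \<open>G\<close>. This recovers the measure of an open set from cylinder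
  masses alone, which is what makes the scaling law for balls provable.\<close>

lemma inner_tendsto:
  assumes "open G"
  shows "(\<lambda>k. \<Sum>w\<in>{w\<in>W k. cyl w \<subseteq> G}. mass w) \<longlonglongrightarrow> measure \<mu> G"
proof -
  define T where "T k = (\<Union>w\<in>{w\<in>W k. cyl w \<subseteq> G}. cyl w)" for k
  have "T k \<subseteq> T (Suc k)" for k
  proof
    fix x assume "x \<in> T k"
    then obtain w where w: "w \<in> W k" "cyl w \<subseteq> G" "x \<in> cyl w" by (auto simp: T_def)
    obtain v where v: "v \<in> W 1" "x \<in> cyl (w @ v)" using cyl_cyl_cases[OF w(3)] by blast
    have "w @ v \<in> W (Suc k)" using W_append[OF w(1) v(1)] by simp
    moreover have "cyl (w @ v) \<subseteq> G" using cyl_append_subset[OF WD(1)[OF v(1)]] w(2) by blast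
    ultimately show "x \<in> T (Suc k)" using v(2) by (auto simp: T_def)
  qed
  then have inc: "incseq T" by (rule incseq_SucI)
  have un: "(\<Union>k. T k) = G \<inter> E"
  proof
    show "(\<Union>k. T k) \<subseteq> G \<inter> E" using cyl_subset_E WD(1) by (fastforce simp: T_def)
    show "G \<inter> E \<subseteq> (\<Union>k. T k)"
    proof
      fix x assume x: "x \<in> G \<inter> E"
      then obtain e where e: "e > 0" "ball x e \<subseteq> G" using assms open_contains_ball by blast
      obtain k where k: "rmax ^ k < e"
        using real_arch_pow_inv[OF e(1) rmax_less_1] by blast
      obtain w where w: "w \<in> W k" "x \<in> cyl w" using x E_cyl_cases by blast
      have "cyl w \<subseteq> ball x e" using dist_cyl[OF w] k by fastforce
      then show "x \<in> (\<Union>k. T k)" using w e(2) by (auto simp: T_def)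
    qed
  qed
  have "(\<lambda>k. measure \<mu> (T k)) \<longlonglongrightarrow> measure \<mu> (\<Union>k. T k)"
  proof (rule mu.finite_Lim_measure_incseq[OF _ inc])
    show "range T \<subseteq> sets \<mu>"
      using sets_cyl WD(1) by (auto simp: T_def intro!: sets.finite_UN)
  qed
  moreover have "measure \<mu> (T k) = (\<Sum>w\<in>{w\<in>W k. cyl w \<subseteq> G}. mass w)" for k
    unfolding T_def by (rule measure_UN_cyl) auto
  moreover have "measure \<mu> (\<Union>k. T k) = measure \<mu> G"
    using un measure_Int_E[OF sets_open[OF assms]] by simp
  ultimately show ?thesis by simp
qed

text \<open>The ball contains the level \<open>k\<close> cylinder of its centre. The bound does not
  depend on \<open>x\<close>, which later makes \<open>h\<close> bounded.\<close>

lemma measure_ball_ge: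
  assumes "x \<in> E" "rmax ^ k < d"
  shows "(rmin ^ k) powr s \<le> measure \<mu> (ball x d)"
proof -
  obtain w where w: "w \<in> W k" "x \<in> cyl w" using E_cyl_cases[OF assms(1)] by blast
  have "cyl w \<subseteq> ball x d" using dist_cyl[OF w] assms(2) by fastforce
  then have "mass w \<le> measure \<mu> (ball x d)"
    using sum_mass_le_measure[of "ball x d" "{w}" k] w(1) sets_open by auto
  then show ?thesis using mass_ge[OF w(1)] by simp
qed

lemma measure_ball_pos:
  assumes "x \<in> E" "0 < d" shows "0 < measure \<mu> (ball x d)"
proof -
  obtain k where k: "rmax ^ k < d" using real_arch_pow_inv[OF assms(2) rmax_less_1] by blast
  have "0 < (rmin ^ k) powr s" using rmin_pos by simp
  then show ?thesis using measure_ball_ge[OF assms(1) k] by linarith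
qed

section \<open>The discrete approximations\<close>

definition fixpt :: "nat \<Rightarrow> real ^ 'n" where
  "fixpt i = (SOME x. x \<in> E \<and> f i x = x)"

text \<open>For nonempty \<open>w\<close> this is the point of the discrete set with address
  \<open>w\<close>. On the empty word \<open>last\<close> is unspecified, so only nonempty words
  matter.\<close>

definition pt :: "nat list \<Rightarrow> real ^ 'n" where
  "pt w = word_map f w (fixpt (last w))"

lemma fixpt: assumes "i \<in> {1..N}" shows "fixpt i \<in> E" "f i (fixpt i) = fixpt i"
proof -
  have "\<exists>!x\<in>E. f i x = x"
  proof (rule Banach_fix)
    show "uniform_space_class.complete E" using compact_E by (rule compact_imp_complete)
    show "f i ` E \<subseteq> E" using f_in_E assms by blast
    show "dist (f i x) (f i y) \<le> r i * dist x y" for x y using dist_f[OF assms] by simp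
  qed (use E_nonempty r_pos[OF assms] r_less_1[OF assms] in auto)
  then have "\<exists>x. x \<in> E \<and> f i x = x" by blast
  then show "fixpt i \<in> E" "f i (fixpt i) = fixpt i" unfolding fixpt_def
    using someI_ex[of "\<lambda>x. x \<in> E \<and> f i x = x"] by blast+
qed

lemma fixpt_unique: assumes "i \<in> {1..N}" "f i x = x" shows "x = fixpt i"
proof -
  have "dist x (fixpt i) = r i * dist x (fixpt i)"
    using dist_f[OF assms(1), of x "fixpt i"] assms fixpt(2) by simp
  then show ?thesis using r_less_1[OF assms(1)] by simp
qed

lemma A_pts_1: "A_pts N f (Suc 0) = fixpt ` {1..N}"
proof -
  have "(\<exists>i\<in>{1..N}. f i x = x) \<longleftrightarrow> (\<exists>i\<in>{1..N}. x = fixpt i)" for x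
    using fixpt(2) fixpt_unique by metis
  then show ?thesis unfolding A_pts.simps by blast
qed

lemma pt_Cons: "w \<noteq> [] \<Longrightarrow> pt (i # w) = f i (pt w)"
  by (simp add: pt_def)

lemma A_pts_eq: "A_pts N f (Suc k) = pt ` W (Suc k)"
proof (induction k)
  case 0
  have "W (Suc 0) = (\<lambda>i. [i]) ` {1..N}" by (auto elim!: W_Suc_cases)
  then have "pt ` W (Suc 0) = (\<lambda>i. pt [i]) ` {1..N}" by (simp add: image_image)
  also have "\<dots> = fixpt ` {1..N}" using fixpt(2) by (intro image_cong) (auto simp: pt_def)
  finally show ?case unfolding A_pts_1 by simp
next
  case (Suc k)
  have "W (Suc (Suc k)) = (\<Union>i\<in>{1..N}. (#) i ` W (Suc k))" by (auto elim!: W_Suc_cases)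
  moreover have "pt (i # w) = f i (pt w)" if "w \<in> W (Suc k)" for i w
    using that WD(2) by (intro pt_Cons) fastforce
  ultimately show ?case unfolding A_pts.simps Suc by (simp add: image_UN image_image)
qed

text \<open>A fixed point is its own image, which settles the first level; applying the maps
  propagates the inclusion.\<close>

lemma A_pts_mono: "A_pts N f k \<subseteq> A_pts N f (Suc k)"
proof (induction k)
  case (Suc k)
  show ?case
  proof (cases k)
    case 0
    have "fixpt i \<in> (\<Union>i\<in>{1..N}. f i ` A_pts N f (Suc 0))" if "i \<in> {1..N}" for i
      using that fixpt(2)[OF that] A_pts_1 by (metis UN_I image_eqI)
    then show ?thesis using 0 A_pts_1 by auto
  next
    case (Suc l)
    have "A_pts N f (Suc k) = (\<Union>i\<in>{1..N}. f i ` A_pts N f k)"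
      unfolding Suc by (rule A_pts.simps)
    also have "\<dots> \<subseteq> (\<Union>i\<in>{1..N}. f i ` A_pts N f (Suc k))"
      by (intro UN_mono image_mono Suc.IH order_refl)
    also have "\<dots> = A_pts N f (Suc (Suc k))" by (rule A_pts.simps(3)[symmetric])
    finally show ?thesis .
  qed
qed simp

lemma pt_in_cyl: assumes "w \<in> W (Suc k)" shows "pt w \<in> cyl w"
proof -
  have "w \<noteq> []" using assms WD(2) by fastforce
  then have "last w \<in> {1..N}" using WD(1)[OF assms] last_in_set by blast
  then show ?thesis using fixpt(1) by (auto simp: pt_def cyl_def)
qed

lemma pt_in_E: "w \<in> W (Suc k) \<Longrightarrow> pt w \<in> E"
  using pt_in_cyl cyl_subset_E WD(1) by blast

lemma A_pts_subset_E: "A_pts N f k \<subseteq> E"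
  by (cases k) (auto simp: A_pts_eq pt_in_E simp del: A_pts.simps(2,3))

lemma finite_A_pts: "finite (A_pts N f k)"
  by (cases k) (auto simp: A_pts_eq simp del: A_pts.simps(2,3))

lemma inj_pt: "inj_on pt (W (Suc k))"
  by (rule inj_onI) (metis cyl_disjoint disjoint_iff pt_in_cyl)

text \<open>Any admissible word for \<open>pt w\<close> has a cylinder containing
  \<open>pt w\<close>, and cylinders of one level are disjoint.\<close>

lemma address_pt:
  assumes w: "w \<in> W (Suc k)" shows "address N f (Suc k) (pt w) = w"
  unfolding address_def
proof (rule the_equality)
  have "w \<noteq> []" using WD(2)[OF w] by auto
  then have "last w \<in> {1..N}" using WD(1)[OF w] last_in_set by blast
  then have "\<exists>y\<in>A_pts N f 1. pt w = word_map f w y"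
    unfolding One_nat_def A_pts_1 pt_def by blast
  then show "length w = Suc k \<and> set w \<subseteq> {1..N} \<and> (\<exists>y\<in>A_pts N f 1. pt w = word_map f w y)"
    using WD[OF w] by simp
next
  fix v assume v: "length v = Suc k \<and> set v \<subseteq> {1..N} \<and> (\<exists>y\<in>A_pts N f 1. pt w = word_map f v y)"
  then have "pt w \<in> cyl v" using A_pts_subset_E[of 1] by (auto simp: cyl_def)
  moreover have "v \<in> W (Suc k)" using v by (simp add: W_def)
  ultimately show "v = w" using cyl_disjoint[OF w] pt_in_cyl[OF w] by blast
qed

section \<open>Comparison of the discrete measures with the natural measure\<close>

lemma measure_mu_disc:
  "measure (mu_disc N f r s (Suc k)) B = (\<Sum>w\<in>{w\<in>W (Suc k). pt w \<in> B}. mass w)"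
proof -
  let ?A = "A_pts N f (Suc k)"
  let ?g = "\<lambda>x. if x \<in> ?A then ennreal (ratio (address N f (Suc k) x) powr s) else 0"
  have g: "?g (pt w) = ennreal (mass w)" if "w \<in> W (Suc k)" for w
    using that address_pt[OF that] by (simp add: A_pts_eq mass_def del: A_pts.simps)
  have supp: "{a \<in> B. 0 < ?g a} = pt ` {w\<in>W (Suc k). pt w \<in> B}"
  proof -
    have "{a \<in> B. 0 < ?g a} = {a \<in> ?A. a \<in> B \<and> 0 < ?g a}" by auto
    also have "\<dots> = pt ` {w\<in>W (Suc k). pt w \<in> B}"
      using g mass_pos WD(1) unfolding A_pts_eq by (fastforce simp: image_iff)
    finally show ?thesis .
  qed
  have "emeasure (mu_disc N f r s (Suc k)) B = (\<Sum>a\<in>{a \<in> B. 0 < ?g a}. ?g a)"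
    unfolding mu_disc_def by (subst emeasure_point_measure) (auto simp: supp simp del: A_pts.simps)
  also have "\<dots> = (\<Sum>w\<in>{w\<in>W (Suc k). pt w \<in> B}. ?g (pt w))"
    unfolding supp by (subst sum.reindex) (auto intro: inj_on_subset[OF inj_pt])
  also have "\<dots> = (\<Sum>w\<in>{w\<in>W (Suc k). pt w \<in> B}. ennreal (mass w))"
    using g by (intro sum.cong) auto
  also have "\<dots> = ennreal (\<Sum>w\<in>{w\<in>W (Suc k). pt w \<in> B}. mass w)"
    by (intro sum_ennreal) (auto simp: mass_def)
  finally show ?thesis
    by (simp add: measure_def sum_nonneg mass_def)
qed

text \<open>The atom at \<open>pt w\<close> carries exactly the mass of \<open>cyl w\<close>, and
  all of that cylinder lies within \<open>rmax ^ Suc k\<close> of the atom. The reverse comparison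
  below rests on the same fact.\<close>

lemma measure_mu_disc_le:
  "measure (mu_disc N f r s (Suc k)) (ball x d) \<le> measure \<mu> (ball x (d + rmax ^ Suc k))"
  unfolding measure_mu_disc
proof (rule sum_mass_le_measure)
  fix w assume w: "w \<in> {w\<in>W (Suc k). pt w \<in> ball x d}"
  show "cyl w \<subseteq> ball x (d + rmax ^ Suc k)"
  proof
    fix y assume "y \<in> cyl w"
    then have "dist (pt w) y \<le> rmax ^ Suc k" using w dist_cyl pt_in_cyl by blast
    then show "y \<in> ball x (d + rmax ^ Suc k)" using w dist_triangle[of x y "pt w"] by simp
  qed
qed (auto simp: sets_open)

lemma measure_mu_disc_ge:
  "measure \<mu> (ball x d) \<le> measure (mu_disc N f r s (Suc k)) (ball x (d + rmax ^ Suc k))"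
  unfolding measure_mu_disc
proof (rule measure_le_sum_mass)
  fix w assume w: "w \<in> W (Suc k)" "cyl w \<inter> ball x d \<noteq> {}"
  then obtain y where y: "y \<in> cyl w" "dist x y < d" by auto
  have "dist y (pt w) \<le> rmax ^ Suc k" using w y dist_cyl pt_in_cyl by blast
  then show "w \<in> {w\<in>W (Suc k). pt w \<in> ball x (d + rmax ^ Suc k)}"
    using w y dist_triangle[of x "pt w" y] by simp
qed (auto simp: sets_open)

text \<open>Each of the two points is within \<open>rmax ^ k\<close> of a point of
  \<open>A_pts N f k\<close> with the same first letter; the two displacements account for the
  subtracted \<open>2 * rmax ^ k\<close>.\<close>

lemma c_tilde_le_dist:
  assumes "k \<ge> 1" "i \<in> {1..N}" "j \<in> {1..N}" "i \<noteq> j" "x \<in> f i ` E" "y \<in> f j ` E"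
  shows "c_tilde N f r k \<le> dist x y"
proof -
  obtain l where k: "k = Suc l" using assms(1) by (cases k) auto
  have approx: "\<exists>v. i # v \<in> W k \<and> x \<in> cyl (i # v)" if "i \<in> {1..N}" "x \<in> f i ` E" for i x
    using that E_cyl_cases[of _ l] unfolding k by (fastforce simp: cyl_Cons)
  obtain u where u: "i # u \<in> W k" "x \<in> cyl (i # u)" using approx assms by metis
  obtain v where v: "j # v \<in> W k" "y \<in> cyl (j # v)" using approx assms by metis
  let ?S = "{dist x y | x y. x \<in> A_pts N f k \<and> y \<in> A_pts N f k \<and>
     hd (address N f k x) \<noteq> hd (address N f k y)}"
  have "?S \<subseteq> (\<lambda>(x, y). dist x y) ` (A_pts N f k \<times> A_pts N f k)" by auto
  then have "finite ?S" using finite_A_pts finite_subset by blast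
  moreover have "dist (pt (i # u)) (pt (j # v)) \<in> ?S"
    using u(1) v(1) assms(4) address_pt unfolding k A_pts_eq
    by (intro CollectI exI[of _ "pt (i # u)"] exI[of _ "pt (j # v)"]) auto
  ultimately have "c_gap N f k \<le> dist (pt (i # u)) (pt (j # v))"
    unfolding c_gap_def by (rule Min_le)
  also have "\<dots> \<le> dist (pt (i # u)) x + dist x y + dist y (pt (j # v))"
    using dist_triangle[of "pt (i # u)" "pt (j # v)" x] dist_triangle[of x "pt (j # v)" y]
    by linarith
  also have "\<dots> \<le> rmax ^ k + dist x y + rmax ^ k"
    using dist_cyl[OF u(1) pt_in_cyl[OF u(1)[unfolded k]] u(2)]
      dist_cyl[OF v(1) v(2) pt_in_cyl[OF v(1)[unfolded k]]]
    by simp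
  finally show ?thesis by (simp add: c_tilde_def)
qed

end

section \<open>Separation and scaling\<close>

text \<open>The constant enters the further argument as a positive lower bound for the distances
  between first level pieces; \<open>c_tilde\<close> is one instance.\<close>

locale separated_system = self_similar_system N f r s E \<mu>
  for N :: nat and f :: "nat \<Rightarrow> real ^ 'n \<Rightarrow> real ^ 'n" and r :: "nat \<Rightarrow> real" and s :: real
    and E :: "(real ^ 'n) set" and \<mu> :: "(real ^ 'n) measure" +
  fixes c :: real
  assumes c_pos: "c > 0"
    and gap: "\<And>i j x y. \<lbrakk>i \<in> {1..N}; j \<in> {1..N}; i \<noteq> j; x \<in> f i ` E; y \<in> f j ` E\<rbrakk> \<Longrightarrow> c \<le> dist x y"
begin

text \<open>Strip the common prefix of the two words: the remaining points are at least
  \<open>c\<close> apart, and the ratio of the prefix is at least \<open>ratio w\<close>.\<close>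

lemma dist_cyl_ge:
  "w \<in> W k \<Longrightarrow> w' \<in> W k \<Longrightarrow> w \<noteq> w' \<Longrightarrow> x \<in> cyl w \<Longrightarrow> y \<in> cyl w' \<Longrightarrow> c * ratio w \<le> dist x y"
proof (induction k arbitrary: w w' x y)
  case (Suc k)
  obtain i v where w: "w = i # v" "i \<in> {1..N}" "v \<in> W k" using Suc.prems(1) by (elim W_Suc_cases)
  obtain j u where w': "w' = j # u" "j \<in> {1..N}" "u \<in> W k" using Suc.prems(2) by (elim W_Suc_cases)
  obtain x' where x': "x' \<in> cyl v" "x = f i x'" using Suc.prems(4) w by (auto simp: cyl_Cons)
  obtain y' where y': "y' \<in> cyl u" "y = f j y'" using Suc.prems(5) w' by (auto simp: cyl_Cons)
  show ?case
  proof (cases "i = j")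
    case True
    then have "c * ratio v \<le> dist x' y'" using Suc.IH[OF w(3) w'(3) _ x'(1) y'(1)] Suc.prems(3) w w' by simp
    then show ?thesis using True x' y' w r_pos[OF w(2)] dist_f[OF w(2)] by (simp add: mult.left_commute)
  next
    case False
    have "x' \<in> E" "y' \<in> E"
      using x' y' cyl_subset_E[OF WD(1)[OF w(3)]] cyl_subset_E[OF WD(1)[OF w'(3)]] by auto
    then have "c \<le> dist x y" using gap[OF w(2) w'(2) False] x' y' by blast
    moreover have "c * ratio w \<le> c" using ratio_le_1[OF Suc.prems(1)] c_pos by (simp add: mult_left_le)
    ultimately show ?thesis by linarith
  qed
qed simp

lemma measure_ball_scale:
  assumes i: "i \<in> {1..N}" and x: "x \<in> E" and d: "r i * d \<le> c"
  shows "measure \<mu> (ball (f i x) (r i * d)) = r i powr s * measure \<mu> (ball x d)"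
proof (rule LIMSEQ_unique)
  let ?I = "\<lambda>G k. \<Sum>w\<in>{w\<in>W k. cyl w \<subseteq> G}. mass w"
  show "(\<lambda>k. ?I (ball (f i x) (r i * d)) (Suc k)) \<longlonglongrightarrow> measure \<mu> (ball (f i x) (r i * d))"
    by (intro LIMSEQ_Suc inner_tendsto) simp
  have sub: "cyl (i # v) \<subseteq> ball (f i x) (r i * d) \<longleftrightarrow> cyl v \<subseteq> ball x d" for v
    using r_pos[OF i] by (auto simp: cyl_Cons dist_f[OF i])
  have "{w\<in>W (Suc k). cyl w \<subseteq> ball (f i x) (r i * d)} = (#) i ` {w\<in>W k. cyl w \<subseteq> ball x d}" for k
  proof
    show "(#) i ` {w\<in>W k. cyl w \<subseteq> ball x d} \<subseteq> {w\<in>W (Suc k). cyl w \<subseteq> ball (f i x) (r i * d)}"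
      using sub i by auto
    show "{w\<in>W (Suc k). cyl w \<subseteq> ball (f i x) (r i * d)} \<subseteq> (#) i ` {w\<in>W k. cyl w \<subseteq> ball x d}"
    proof
      fix w assume w: "w \<in> {w\<in>W (Suc k). cyl w \<subseteq> ball (f i x) (r i * d)}"
      then obtain j v where jv: "w = j # v" "j \<in> {1..N}" "v \<in> W k" by (auto elim: W_Suc_cases)
      obtain y where y: "y \<in> cyl v" using cyl_nonempty by blast
      then have "y \<in> E" using cyl_subset_E[OF WD(1)[OF jv(3)]] by blast
      \<comment> \<open>The inequality is strict because the ball is open, so the borderline radius
        \<open>r i * d = c\<close> is covered.\<close>
      moreover have "dist (f i x) (f j y) < c" using w jv y d by (auto simp: cyl_Cons)
      ultimately have "i = j" using gap[OF i jv(2), of "f i x" "f j y"] x by fastforce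
      then show "w \<in> (#) i ` {w\<in>W k. cyl w \<subseteq> ball x d}" using w jv sub by auto
    qed
  qed
  then have "?I (ball (f i x) (r i * d)) (Suc k) = (\<Sum>w\<in>{w\<in>W k. cyl w \<subseteq> ball x d}. mass (i # w))" for k
    by (simp add: sum.reindex)
  also have "\<dots> k = r i powr s * ?I (ball x d) k" for k
    unfolding sum_distrib_left using i WD(1) by (intro sum.cong refl mass_Cons) auto
  finally show "(\<lambda>k. ?I (ball (f i x) (r i * d)) (Suc k)) \<longlonglongrightarrow> r i powr s * measure \<mu> (ball x d)"
    using tendsto_mult_left[OF inner_tendsto[of "ball x d"]] by simp
qed

section \<open>The quotient \<open>h\<close> and its supremum\<close>

definition h :: "real ^ 'n \<Rightarrow> real \<Rightarrow> real" where
  "h x d = (2 * d) powr s / measure \<mu> (ball x d)"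

lemma h_scale:
  assumes "i \<in> {1..N}" "x \<in> E" "0 < d" "r i * d \<le> c"
  shows "h (f i x) (r i * d) = h x d"
proof -
  have "(2 * (r i * d)) powr s = r i powr s * (2 * d) powr s"
    using r_pos[OF assms(1)] assms(3) by (simp add: powr_mult mult.left_commute)
  then show ?thesis
    unfolding h_def measure_ball_scale[OF assms(1,2,4)] using r_pos[OF assms(1)] by simp
qed

definition hsup :: real where
  "hsup = (SUP (x, d)\<in>E \<times> {c..c / rmin}. h x d)"

lemma c_less: "c < c / rmin"
  using c_pos rmin_pos rmin_less_1 by (simp add: less_divide_eq)

lemma h_bdd_above: "bdd_above ((\<lambda>(x, d). h x d) ` (E \<times> {c..c / rmin}))"
proof -
  obtain k where k: "rmax ^ k < c" using real_arch_pow_inv[OF c_pos rmax_less_1] by blast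
  have "h x d \<le> (2 * (c / rmin)) powr s / (rmin ^ k) powr s" if "x \<in> E" "d \<in> {c..c / rmin}" for x d
    unfolding h_def
    using that k c_pos s_pos rmin_pos measure_ball_ge[OF that(1), of k d]
    by (intro frac_le powr_mono2) auto
  then show ?thesis
    by (intro bdd_aboveI2[where M = "(2 * (c / rmin)) powr s / (rmin ^ k) powr s"]) auto
qed

text \<open>A pair with radius below \<open>c\<close> is magnified by the inverse of the map whose
  piece contains the centre. This keeps \<open>h\<close>, gains at least the factor
  \<open>1 / rmax\<close>, and cannot jump beyond \<open>c / rmin\<close>; the number
  \<open>n\<close> bounds how many magnifications are required.\<close>

lemma h_le_hsup:
  assumes "x \<in> E" "0 < d" "d \<le> c / rmin" shows "h x d \<le> hsup"
proof -
  have "h x d \<le> hsup" if "x \<in> E" "0 < d" "d \<le> c / rmin" "rmax ^ n * c \<le> d" for n x d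
    using that
  proof (induction n arbitrary: x d)
    case 0
    then show ?case unfolding hsup_def
      using cSUP_upper[OF _ h_bdd_above, of "(x, d)"] by simp
  next
    case (Suc n)
    show ?case
    proof (cases "c \<le> d")
      case True
      then show ?thesis unfolding hsup_def
        using cSUP_upper[OF _ h_bdd_above, of "(x, d)"] Suc.prems by simp
    next
      case False
      obtain i y where i: "i \<in> {1..N}" "y \<in> E" "x = f i y" using Suc.prems(1) by (rule E_cases)
      have r: "0 < r i" "rmin \<le> r i" "r i \<le> rmax" using i r_pos rmin_le le_rmax by auto
      have "h y (d / r i) \<le> hsup"
      proof (rule Suc.IH[OF i(2)])
        show "0 < d / r i" using r Suc.prems by simp
        show "d / r i \<le> c / rmin" using r False rmin_pos Suc.prems by (intro frac_le) auto
        have "rmax ^ n * c * r i \<le> rmax ^ n * c * rmax"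
          using r c_pos rmax_pos by (intro mult_left_mono) auto
        also have "\<dots> \<le> d" using Suc.prems by (simp add: mult_ac)
        finally show "rmax ^ n * c \<le> d / r i" using r by (simp add: le_divide_eq)
      qed
      then show ?thesis using h_scale[OF i(1,2), of "d / r i"] r False Suc.prems i(3) by simp
    qed
  qed
  moreover
  obtain n where "rmax ^ n < d / c"
    using real_arch_pow_inv[OF _ rmax_less_1, of "d / c"] assms c_pos by auto
  then have "rmax ^ n * c \<le> d" using c_pos by (simp add: less_divide_eq)
  ultimately show ?thesis using assms by blast
qed

lemma powr_le_hsup:
  assumes "x \<in> E" "0 < d" "d \<le> c / rmin"
  shows "(2 * d) powr s \<le> hsup * measure \<mu> (ball x d)"
  using h_le_hsup[OF assms] measure_ball_pos[OF assms(1,2)] by (simp add: h_def divide_le_eq)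

lemma hsup_pos: "0 < hsup"
proof -
  obtain x where x: "x \<in> E" using E_nonempty by blast
  have "0 < h x c" unfolding h_def using measure_ball_pos[OF x c_pos] c_pos by simp
  then show ?thesis using h_le_hsup[OF x c_pos] c_less by linarith
qed

text \<open>The strict inequality \<open>c < d\<close> leaves room to shrink the radius in the
  discretisation. At \<open>d = c\<close> one magnification produces a larger radius with the same
  value of \<open>h\<close>.\<close>

lemma ex_h_greater:
  assumes "t < hsup"
  obtains x d where "x \<in> E" "c < d" "d \<le> c / rmin" "t < h x d"
proof -
  obtain p where p: "p \<in> E \<times> {c..c / rmin}" "t < (\<lambda>(x, d). h x d) p"
  proof -
    have "E \<times> {c..c / rmin} \<noteq> {}" using E_nonempty c_less by auto
    then show ?thesis using assms that h_bdd_above unfolding hsup_def by (subst (asm) less_cSUP_iff) auto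
  qed
  obtain x d where xd: "x \<in> E" "c \<le> d" "d \<le> c / rmin" "t < h x d"
    using p by (cases p) auto
  show ?thesis
  proof (cases "d = c")
    case True
    obtain i y where i: "i \<in> {1..N}" "y \<in> E" "x = f i y" using xd(1) by (rule E_cases)
    have r: "0 < r i" "rmin \<le> r i" "r i < 1" using i r_pos rmin_le r_less_1 by auto
    have "h x d = h y (c / r i)"
      using h_scale[OF i(1,2), of "c / r i"] r c_pos True i(3) by simp
    moreover have "c < c / r i" using r c_pos by (simp add: less_divide_eq)
    moreover have "c / r i \<le> c / rmin" using r rmin_pos c_pos by (intro frac_le) auto
    ultimately show ?thesis using that[OF i(2), of "c / r i"] xd by simp
  next
    case False
    then show ?thesis using xd by (intro that[of x d]) auto
  qed
qed

lemma packing_premeasure_at_le_hsup: "packing_premeasure_at s (2 * c) E \<le> ennreal hsup"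
proof (rule packing_premeasure_at_le[OF prob_mu sets_mu])
  fix x \<rho> assume x: "x \<in> E" "0 < \<rho>" "2 * \<rho> \<le> 2 * c"
  have "(2 * \<rho>) powr s \<le> hsup * measure \<mu> (ball x \<rho>)"
    using x c_less by (intro powr_le_hsup) auto
  also have "\<dots> \<le> hsup * measure \<mu> (cball x \<rho>)"
    using hsup_pos by (intro mult_left_mono mu.finite_measure_mono) (auto simp: sets_closed)
  finally show "(2 * \<rho>) powr s \<le> hsup * measure \<mu> (cball x \<rho>)" .
qed (use hsup_pos in auto)

lemma packing_measure_le_hsup: "packing_measure s E \<le> ennreal hsup"
  using packing_measure_le_premeasure[of s E] packing_premeasure_le[of "2 * c" s E]
    packing_premeasure_at_le_hsup c_pos
  by (meson mult_pos_pos order_trans zero_less_numeral)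

section \<open>The packing measure as a supremum\<close>

text \<open>Pairs consist of a centre and a radius. Radii below \<open>c / 2\<close> guarantee that
  scaled copies placed in different cylinders stay disjoint.\<close>

definition finite_packings :: "((real ^ 'n) \<times> real) set set" where
  "finite_packings = {Q. finite Q \<and> (\<forall>p\<in>Q. fst p \<in> E \<and> 0 < snd p \<and> snd p < c / 2) \<and>
     (\<forall>p\<in>Q. \<forall>q\<in>Q. p \<noteq> q \<longrightarrow> snd p + snd q < dist (fst p) (fst q))}"

definition packval :: "((real ^ 'n) \<times> real) set \<Rightarrow> real" where
  "packval Q = (\<Sum>p\<in>Q. (2 * snd p) powr s)"

lemma finite_packingsD:
  assumes "Q \<in> finite_packings"
  shows "finite Q" "\<And>p. p \<in> Q \<Longrightarrow> fst p \<in> E" "\<And>p. p \<in> Q \<Longrightarrow> 0 < snd p"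
    "\<And>p. p \<in> Q \<Longrightarrow> snd p < c / 2"
    "\<And>p q. p \<in> Q \<Longrightarrow> q \<in> Q \<Longrightarrow> p \<noteq> q \<Longrightarrow> snd p + snd q < dist (fst p) (fst q)"
  using assms by (auto simp: finite_packings_def)

lemma packval_nonneg: "0 \<le> packval Q"
  by (simp add: packval_def sum_nonneg)

lemma finite_packings_family:
  assumes "finite I" and "\<And>i. i \<in> I \<Longrightarrow> X i \<in> E \<and> 0 < R i \<and> R i < c / 2"
    and "\<And>i j. i \<in> I \<Longrightarrow> j \<in> I \<Longrightarrow> i \<noteq> j \<Longrightarrow> R i + R j < dist (X i) (X j)"
  shows "(\<lambda>i. (X i, R i)) ` I \<in> finite_packings"
    and "packval ((\<lambda>i. (X i, R i)) ` I) = (\<Sum>i\<in>I. (2 * R i) powr s)"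
proof -
  show "(\<lambda>i. (X i, R i)) ` I \<in> finite_packings"
    unfolding finite_packings_def using assms by fastforce
  have "inj_on (\<lambda>i. (X i, R i)) I"
  proof (rule inj_onI, rule ccontr)
    fix i j assume *: "i \<in> I" "j \<in> I" "(X i, R i) = (X j, R j)" "i \<noteq> j"
    then show False using assms(2)[OF *(1)] assms(3)[OF *(1,2,4)] by simp
  qed
  then show "packval ((\<lambda>i. (X i, R i)) ` I) = (\<Sum>i\<in>I. (2 * R i) powr s)"
    by (simp add: packval_def sum.reindex)
qed

lemma packval_le_hsup:
  assumes "Q \<in> finite_packings" shows "packval Q \<le> hsup"
proof -
  have "ennreal (packval Q) \<le> packing_premeasure_at s (2 * c) E"
    unfolding packval_def
  proof (rule finite_family_le_packing_premeasure_at)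
    fix p assume "p \<in> Q"
    then show "fst p \<in> E \<and> 0 < snd p \<and> 2 * snd p \<le> 2 * c"
      using finite_packingsD(2-4)[OF assms] c_pos by fastforce
  qed (use finite_packingsD[OF assms] in blast)+
  also have "\<dots> \<le> ennreal hsup" by (rule packing_premeasure_at_le_hsup)
  finally show ?thesis using hsup_pos by (simp add: ennreal_le_iff)
qed

text \<open>The distance is at least \<open>c\<close> times either ratio, hence at least the mean of
  the two bounds.\<close>

lemma dist_cyl_gt:
  assumes "w \<in> W k" "w' \<in> W k" "w \<noteq> w'" "x \<in> cyl w" "y \<in> cyl w'" "\<rho> < c / 2" "\<rho>' < c / 2"
  shows "ratio w * \<rho> + ratio w' * \<rho>' < dist x y"
proof -
  have "ratio w * \<rho> < ratio w * (c / 2)" "ratio w' * \<rho>' < ratio w' * (c / 2)"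
    using assms ratio_pos WD(1) by simp_all
  moreover have "c * ratio w \<le> dist x y" "c * ratio w' \<le> dist x y"
    using dist_cyl_ge[OF assms(1,2,3,4,5)] dist_cyl_ge[OF assms(2,1) _ assms(5,4)] assms(3)
    by (auto simp: dist_commute)
  ultimately show ?thesis by (simp add: mult.commute)
qed

text \<open>Scaled copies of \<open>Q\<close> are placed into small cylinders that do not meet \<open>cball x \<rho>\<close>; such
  cylinders carry all the mass outside \<open>ball x d\<close>.\<close>

lemma extend_packing:
  assumes Q: "Q \<in> finite_packings" and x: "x \<in> E" and \<rho>: "0 < \<rho>" "\<rho> < c / 2" "\<rho> < d"
  obtains Q' where "Q' \<in> finite_packings"
    "(2 * \<rho>) powr s + (1 - measure \<mu> (ball x d)) * packval Q \<le> packval Q'"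
proof -
  note QD = finite_packingsD[OF Q]
  \<comment> \<open>In \<open>c + 1\<close>, the summand \<open>c\<close> leaves room for the radii
    of the scaled balls and the summand 1 for the diameter of a level \<open>k\<close>
    cylinder.\<close>
  have "0 < (d - \<rho>) / (c + 1)" using \<rho> c_pos by simp
  then obtain k where "rmax ^ k < (d - \<rho>) / (c + 1)"
    using real_arch_pow_inv[OF _ rmax_less_1] by blast
  then have k: "rmax ^ k * (c + 1) < d - \<rho>" using c_pos by (simp add: less_divide_eq)
  define V where "V = {w\<in>W k. cyl w \<inter> cball x (\<rho> + rmax ^ k * c) = {}}"
  \<comment> \<open>\<open>None\<close> indexes the given ball about \<open>x\<close>;
    \<open>Some (w, q)\<close> indexes the copy of \<open>q\<close> in the cylinder of
    \<open>w\<close>.\<close>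
  define I where "I = insert None (Some ` (V \<times> Q))"
  define X where "X i = (case i of None \<Rightarrow> x | Some (w, q) \<Rightarrow> word_map f w (fst q))" for i :: "(nat list \<times> (real ^ 'n) \<times> real) option"
  define R where "R i = (case i of None \<Rightarrow> \<rho> | Some (w, q) \<Rightarrow> ratio w * snd q)" for i :: "(nat list \<times> (real ^ 'n) \<times> real) option"
  have V: "w \<in> W k" "set w \<subseteq> {1..N}" "0 < ratio w" "ratio w \<le> 1" "ratio w \<le> rmax ^ k" if "w \<in> V" for w
    using that WD ratio_pos ratio_le_1 ratio_le by (auto simp: V_def)
  have finV: "finite V" by (simp add: V_def)
  have in_cyl: "word_map f w (fst q) \<in> cyl w" if "q \<in> Q" for w q
    using QD(2)[OF that] by (auto simp: cyl_def)
  have far: "\<rho> + ratio w * snd q < dist x (word_map f w (fst q))" if "w \<in> V" "q \<in> Q" for w q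
  proof -
    have "ratio w * snd q \<le> rmax ^ k * c"
      using V[OF that(1)] QD(3,4)[OF that(2)] by (intro mult_mono) auto
    moreover have "word_map f w (fst q) \<notin> cball x (\<rho> + rmax ^ k * c)"
      using in_cyl[OF that(2), of w] that(1) unfolding V_def by blast
    ultimately show ?thesis by simp
  qed
  have fin: "finite I" using QD(1) finV by (simp add: I_def)
  have mem: "X i \<in> E \<and> 0 < R i \<and> R i < c / 2" if "i \<in> I" for i
  proof (cases i)
    case None
    then show ?thesis using x \<rho> by (simp add: X_def R_def)
  next
    case (Some p)
    then have "p \<in> V \<times> Q" using \<open>i \<in> I\<close> by (auto simp: I_def)
    then obtain w q where wq: "i = Some (w, q)" "w \<in> V" "q \<in> Q" using Some by blast
    have "ratio w * snd q \<le> snd q" using V[OF wq(2)] QD(3)[OF wq(3)] by simp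
    then have "ratio w * snd q < c / 2" using QD(4)[OF wq(3)] by linarith
    then show ?thesis
      using wq V[OF wq(2)] QD(2,3,4)[OF wq(3)] word_map_in_E by (auto simp: X_def R_def)
  qed
  have sep: "R i + R j < dist (X i) (X j)" if ij: "i \<in> I" "j \<in> I" "i \<noteq> j" for i j
  proof (cases "i = None \<or> j = None")
    case True
    then show ?thesis using ij far by (auto simp: I_def X_def R_def dist_commute add.commute)
  next
    case False
    then obtain w q w' q' where wq: "i = Some (w, q)" "w \<in> V" "q \<in> Q" "j = Some (w', q')" "w' \<in> V" "q' \<in> Q"
      using ij(1,2) by (auto simp: I_def)
    show ?thesis
    proof (cases "w = w'")
      case True
      then have "snd q + snd q' < dist (fst q) (fst q')" using ij(3) wq QD(5) by auto
      then have "ratio w * (snd q + snd q') < ratio w * dist (fst q) (fst q')"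
        using V(3)[OF wq(2)] by simp
      then show ?thesis
        using True wq dist_word_map[OF V(2)[OF wq(2)]] by (simp add: X_def R_def distrib_left)
    next
      case False
      then show ?thesis
        using dist_cyl_gt[OF V(1)[OF wq(2)] V(1)[OF wq(5)] False in_cyl in_cyl, of q q' "snd q" "snd q'"]
          wq QD(4) by (simp add: X_def R_def)
    qed
  qed
  have sub: "cyl w \<subseteq> ball x d" if w: "w \<in> W k - V" for w
  proof
    fix y assume y: "y \<in> cyl w"
    obtain z where z: "z \<in> cyl w" "dist x z \<le> \<rho> + rmax ^ k * c" using w by (auto simp: V_def)
    have "dist z y \<le> rmax ^ k" using dist_cyl[OF _ z(1) y] w by blast
    then have "dist x y \<le> \<rho> + rmax ^ k * c + rmax ^ k" using z(2) dist_triangle[of x y z] by linarith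
    then show "y \<in> ball x d" using k by (simp add: distrib_left)
  qed
  have "(\<Sum>w\<in>W k - V. mass w) \<le> measure \<mu> (ball x d)"
    by (rule sum_mass_le_measure[of _ _ k]) (use sub in \<open>auto simp: sets_open\<close>)
  moreover have "(\<Sum>w\<in>W k. mass w) = (\<Sum>w\<in>W k - V. mass w) + (\<Sum>w\<in>V. mass w)"
    by (rule sum.subset_diff) (auto simp: V_def)
  ultimately have massV: "1 - measure \<mu> (ball x d) \<le> (\<Sum>w\<in>V. mass w)"
    using sum_mass_W[of k] by simp
  have "(\<Sum>i\<in>I. (2 * R i) powr s) = (2 * \<rho>) powr s + (\<Sum>i\<in>V \<times> Q. (2 * R (Some i)) powr s)"
    using QD(1) finV by (simp add: I_def sum.reindex image_iff R_def)
  also have "(\<Sum>i\<in>V \<times> Q. (2 * R (Some i)) powr s) = (\<Sum>w\<in>V. \<Sum>q\<in>Q. mass w * (2 * snd q) powr s)"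
    unfolding sum.cartesian_product
  proof (intro sum.cong refl)
    fix i assume "i \<in> V \<times> Q"
    then obtain w q where wq: "i = (w, q)" "w \<in> V" "q \<in> Q" by blast
    have "2 * (ratio w * snd q) = ratio w * (2 * snd q)" by simp
    then show "(2 * R (Some i)) powr s = (case i of (w, q) \<Rightarrow> mass w * (2 * snd q) powr s)"
      using wq V(3)[OF wq(2)] QD(3)[OF wq(3)] by (simp add: R_def mass_def powr_mult)
  qed
  also have "\<dots> = (\<Sum>w\<in>V. mass w) * packval Q"
    by (simp add: packval_def sum_product)
  finally have "(2 * \<rho>) powr s + (1 - measure \<mu> (ball x d)) * packval Q \<le> (\<Sum>i\<in>I. (2 * R i) powr s)"
    using mult_right_mono[OF massV packval_nonneg[of Q]] by simp
  then show thesis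
    using finite_packings_family[where X = X and R = R, OF fin mem sep]
    by (intro that[of "(\<lambda>i. (X i, R i)) ` I"]) simp_all
qed

section \<open>Finite packings with sums close to \<open>hsup\<close>\<close>

definition vsup :: real where
  "vsup = (SUP Q\<in>finite_packings. packval Q)"

lemma empty_finite_packing: "{} \<in> finite_packings"
  by (simp add: finite_packings_def)

lemma packval_le_vsup: "Q \<in> finite_packings \<Longrightarrow> packval Q \<le> vsup"
  unfolding vsup_def using packval_le_hsup
  by (intro cSUP_upper bdd_aboveI2[where M = hsup])

text \<open>Extending packings of nearly maximal sum gives
  \<open>(2 * \<rho>) powr s + (1 - b) * vsup \<le> vsup\<close> with \<open>b\<close> the mass of
  the ball, so \<open>(2 * \<rho>) powr s \<le> b * vsup\<close>; then let \<open>\<rho>\<close>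
  increase to \<open>d\<close>.\<close>

lemma h_le_vsup_small:
  assumes x: "x \<in> E" and d: "0 < d" "d \<le> c / 2"
  shows "h x d \<le> vsup"
proof -
  let ?b = "measure \<mu> (ball x d)"
  have b: "0 < ?b" "?b \<le> 1" using measure_ball_pos[OF x d(1)] by auto
  have "(2 * \<rho>) powr s \<le> ?b * vsup" if \<rho>: "0 < \<rho>" "\<rho> < d" for \<rho>
  proof (cases "?b = 1")
    \<comment> \<open>Division by \<open>1 - ?b\<close> is impossible here, but extending the empty
      packing already gives the bound.\<close>
    case True
    obtain Q' where "Q' \<in> finite_packings" "(2 * \<rho>) powr s + (1 - ?b) * packval {} \<le> packval Q'"
      using extend_packing[OF empty_finite_packing x \<rho>(1) _ \<rho>(2)] \<rho> d by auto
    then show ?thesis using True packval_le_vsup[of Q'] by simp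
  next
    case False
    then have b1: "0 < 1 - ?b" using b by linarith
    have "packval Q \<le> (vsup - (2 * \<rho>) powr s) / (1 - ?b)" if Q: "Q \<in> finite_packings" for Q
    proof -
      obtain Q' where "Q' \<in> finite_packings" "(2 * \<rho>) powr s + (1 - ?b) * packval Q \<le> packval Q'"
        using extend_packing[OF Q x \<rho>(1) _ \<rho>(2)] \<rho> d by auto
      then have "(1 - ?b) * packval Q \<le> vsup - (2 * \<rho>) powr s" using packval_le_vsup[of Q'] by linarith
      then show ?thesis using b1 by (simp add: le_divide_eq mult.commute)
    qed
    then have "vsup \<le> (vsup - (2 * \<rho>) powr s) / (1 - ?b)"
      unfolding vsup_def using empty_finite_packing by (intro cSUP_least) auto
    then have "vsup * (1 - ?b) \<le> vsup - (2 * \<rho>) powr s" using b1 by (simp add: le_divide_eq)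
    then show ?thesis by (simp add: algebra_simps)
  qed
  then have "\<forall>\<^sub>F \<rho> in at_left d. (2 * \<rho>) powr s \<le> ?b * vsup"
    using d(1) by (auto simp: eventually_at_left_field intro!: exI[of _ 0])
  moreover have "((\<lambda>\<rho>. (2 * \<rho>) powr s) \<longlongrightarrow> (2 * d) powr s) (at_left d)"
    using d(1) by (intro tendsto_intros) auto
  ultimately have "(2 * d) powr s \<le> ?b * vsup"
    by (intro tendsto_upperbound[where F = "at_left d"]) auto
  then show ?thesis using b by (simp add: h_def divide_le_eq mult.commute)
qed

text \<open>The map of minimal ratio may be applied to every ball of radius up to
  \<open>c / rmin\<close> without changing \<open>h\<close>, so iterating it brings the radius below
  \<open>c / 2\<close>.\<close>

lemma hsup_le_vsup: "hsup \<le> vsup"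
proof -
  obtain i where i: "i \<in> {1..N}" "r i = rmin" by (rule rmin_attained)
  have le: "h x d \<le> vsup" if "x \<in> E" "0 < d" "d \<le> c / rmin" "rmin ^ n * d \<le> c / 2" for n x d
    using that
  proof (induction n arbitrary: x d)
    case 0
    then show ?case using h_le_vsup_small by simp
  next
    case (Suc n)
    have le_c: "rmin * d \<le> c" using Suc.prems(3) rmin_pos by (simp add: le_divide_eq mult.commute)
    have "h x d = h (f i x) (rmin * d)"
      using h_scale[OF i(1) Suc.prems(1,2)] le_c i(2) by simp
    also have "\<dots> \<le> vsup"
      using Suc.prems i rmin_pos le_c c_less by (intro Suc.IH) (auto simp: f_in_E mult_ac)
    finally show ?case .
  qed
  have "h x d \<le> vsup" if "x \<in> E" "d \<in> {c..c / rmin}" for x d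
  proof -
    have d: "0 < d" "d \<le> c / rmin" using that c_pos by auto
    obtain n where "rmin ^ n < c / 2 / d"
      using real_arch_pow_inv[OF _ rmin_less_1, of "c / 2 / d"] d c_pos by auto
    then have "rmin ^ n * d \<le> c / 2" using d by (simp add: less_divide_eq)
    then show ?thesis using le that d by blast
  qed
  then show ?thesis
    unfolding hsup_def using E_nonempty c_less by (intro cSUP_least) auto
qed

section \<open>Packing premeasure of arbitrary sets\<close>

definition outer_mass :: "nat \<Rightarrow> (real ^ 'n) set \<Rightarrow> real" where
  "outer_mass k U = (\<Sum>w\<in>{w\<in>W k. cyl w \<inter> U \<noteq> {}}. mass w)"

text \<open>The finite union of the cylinders meeting \<open>U\<close> is closed, so it covers the
  closure as well.\<close>

lemma measure_closure_le_outer: "measure \<mu> (closure (U \<inter> E)) \<le> outer_mass k U"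
proof -
  let ?H = "{w\<in>W k. cyl w \<inter> U \<noteq> {}}"
  have closed: "closed (\<Union>w\<in>?H. cyl w)"
    using compact_cyl WD(1) by (intro closed_UN) (auto intro: compact_imp_closed)
  have "U \<inter> E \<subseteq> (\<Union>w\<in>?H. cyl w)" using E_cyl_cases[of _ k] by blast
  then have "closure (U \<inter> E) \<subseteq> (\<Union>w\<in>?H. cyl w)" using closed by (rule closure_minimal)
  then have "measure \<mu> (closure (U \<inter> E)) \<le> measure \<mu> (\<Union>w\<in>?H. cyl w)"
    using closed by (intro mu.finite_measure_mono) (auto simp: sets_closed)
  then show ?thesis using measure_UN_cyl[of ?H k] by (simp add: outer_mass_def)
qed

text \<open>The words in \<open>full_words k l U\<close> carry almost all of \<open>outer_mass k U\<close> for large \<open>k\<close>, because \<open>outer_mass k U\<close> decreases in \<open>k\<close>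
  and so converges.\<close>

definition full_words :: "nat \<Rightarrow> nat \<Rightarrow> (real ^ 'n) set \<Rightarrow> nat list set" where
  "full_words k l U = {w\<in>W k. \<forall>v\<in>W l. cyl (w @ v) \<inter> U \<noteq> {}}"

text \<open>A word that meets \<open>U\<close> but is not full has an extension by \<open>l\<close>
  letters missing \<open>U\<close>, and so loses at least the fraction
  \<open>(rmin ^ l) powr s\<close> of its mass on passing to level \<open>k + l\<close>. The total
  loss is the difference of the outer masses.\<close>

lemma outer_le_full:
  "outer_mass k U - (outer_mass k U - outer_mass (k + l) U) / (rmin ^ l) powr s \<le> (\<Sum>w\<in>full_words k l U. mass w)"
proof -
  let ?H = "{w\<in>W k. cyl w \<inter> U \<noteq> {}}"
  let ?T = "\<lambda>w. {v\<in>W l. cyl (w @ v) \<inter> U \<noteq> {}}"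
  let ?\<beta> = "(rmin ^ l) powr s"
  have \<beta>: "0 < ?\<beta>" using rmin_pos by simp
  have W_l: "W l \<noteq> {}" using E_cyl_cases[of _ l] E_nonempty by blast
  have FH: "full_words k l U \<subseteq> ?H"
    using W_l cyl_append_subset[OF WD(1)] by (fastforce simp: full_words_def)
  have finH: "finite ?H" by simp
  have mass_app: "mass (w @ v) = mass w * mass v" if "w \<in> W k" "v \<in> W l" for w v
    using that WD(1) by (intro mass_append) auto
  \<comment> \<open>Split each word of level \<open>k + l\<close> into its first \<open>k\<close>
    letters, which still meet \<open>U\<close>, and the rest.\<close>
  have eq: "{w\<in>W (k + l). cyl w \<inter> U \<noteq> {}} = (\<lambda>(w, v). w @ v) ` Sigma ?H ?T"
  proof
    show "{w\<in>W (k + l). cyl w \<inter> U \<noteq> {}} \<subseteq> (\<lambda>(w, v). w @ v) ` Sigma ?H ?T"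
    proof
      fix w assume w: "w \<in> {w\<in>W (k + l). cyl w \<inter> U \<noteq> {}}"
      then have "w \<in> W (k + l)" by simp
      then obtain u v where uv: "w = u @ v" "u \<in> W k" "v \<in> W l" by (rule W_append_cases)
      then have "cyl u \<inter> U \<noteq> {}" using w cyl_append_subset[OF WD(1)[OF uv(3)], of u] by blast
      then show "w \<in> (\<lambda>(w, v). w @ v) ` Sigma ?H ?T" using w uv by (intro image_eqI[of _ _ "(u, v)"]) auto
    qed
  qed (auto intro: W_append)
  have inj: "inj_on (\<lambda>(w, v). w @ v) (Sigma ?H ?T)"
    using WD(2) by (fastforce simp: inj_on_def)
  have "outer_mass (k + l) U = (\<Sum>(w, v)\<in>Sigma ?H ?T. mass (w @ v))"
    unfolding outer_mass_def eq using inj by (simp add: sum.reindex case_prod_unfold)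
  also have "\<dots> = (\<Sum>w\<in>?H. \<Sum>v\<in>?T w. mass (w @ v))"
    by (rule sum.Sigma[symmetric]) auto
  also have "\<dots> = (\<Sum>w\<in>?H. mass w * (\<Sum>v\<in>?T w. mass v))"
    using mass_app by (simp add: sum_distrib_left)
  also have "\<dots> \<le> (\<Sum>w\<in>?H. mass w * (if w \<in> full_words k l U then 1 else 1 - ?\<beta>))"
  proof (intro sum_mono mult_left_mono)
    fix w assume w: "w \<in> ?H"
    show "(\<Sum>v\<in>?T w. mass v) \<le> (if w \<in> full_words k l U then 1 else 1 - ?\<beta>)"
    proof (cases "w \<in> full_words k l U")
      case True
      have "(\<Sum>v\<in>?T w. mass v) \<le> (\<Sum>v\<in>W l. mass v)"
        by (intro sum_mono2) (auto simp: mass_def)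
      then show ?thesis using True sum_mass_W by simp
    next
      case False
      then obtain v where v: "v \<in> W l" "cyl (w @ v) \<inter> U = {}" using w by (auto simp: full_words_def)
      have "(\<Sum>v\<in>?T w. mass v) \<le> (\<Sum>v\<in>W l - {v}. mass v)"
        using v by (intro sum_mono2) (auto simp: mass_def)
      also have "\<dots> = 1 - mass v" using v(1) sum_mass_W[of l] by (simp add: sum_diff1)
      also have "\<dots> \<le> 1 - ?\<beta>" using mass_ge[OF v(1)] by simp
      finally show ?thesis using False by simp
    qed
  qed (simp add: mass_def)
  also have "\<dots> = (\<Sum>w\<in>?H. (1 - ?\<beta>) * mass w + ?\<beta> * (if w \<in> full_words k l U then mass w else 0))"
    by (intro sum.cong) (auto simp: algebra_simps)
  also have "\<dots> = (1 - ?\<beta>) * outer_mass k U + ?\<beta> * (\<Sum>w\<in>?H. if w \<in> full_words k l U then mass w else 0)"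
    by (simp add: sum.distrib sum_distrib_left outer_mass_def)
  also have "(\<Sum>w\<in>?H. if w \<in> full_words k l U then mass w else 0) = (\<Sum>w\<in>full_words k l U. mass w)"
    using FH by (intro sum.mono_neutral_cong_right[OF finH]) auto
  finally have "?\<beta> * outer_mass k U - (outer_mass k U - outer_mass (k + l) U) \<le> ?\<beta> * (\<Sum>w\<in>full_words k l U. mass w)"
    by (simp add: algebra_simps)
  then show ?thesis using \<beta> by (simp add: field_simps)
qed

text \<open>The preceding estimate with \<open>l = 1\<close>: full words have total mass at most
  \<open>outer_mass k U\<close>, so the subtracted quotient cannot be negative.\<close>

lemma outer_Suc_le: "outer_mass (Suc k) U \<le> outer_mass k U"
proof -
  have "W 1 \<noteq> {}" using E_cyl_cases[of _ 1] E_nonempty by blast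
  then have "full_words k 1 U \<subseteq> {w\<in>W k. cyl w \<inter> U \<noteq> {}}"
    using cyl_append_subset[OF WD(1)] by (fastforce simp: full_words_def)
  then have "(\<Sum>w\<in>full_words k 1 U. mass w) \<le> outer_mass k U"
    unfolding outer_mass_def by (intro sum_mono2) (auto simp: mass_def)
  then have "0 \<le> (outer_mass k U - outer_mass (k + 1) U) / (rmin ^ 1) powr s"
    using outer_le_full[of k U 1] by linarith
  then show ?thesis using rmin_pos by (simp add: zero_le_divide_iff not_le)
qed

lemma outer_convergent:
  obtains a where "(\<lambda>k. outer_mass k U) \<longlonglongrightarrow> a" "measure \<mu> (closure (U \<inter> E)) \<le> a"
proof -
  have dec: "decseq (\<lambda>k. outer_mass k U)" using outer_Suc_le by (rule decseq_SucI)
  have "0 \<le> outer_mass k U" for k by (simp add: outer_mass_def sum_nonneg mass_def)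
  then obtain a where a: "(\<lambda>k. outer_mass k U) \<longlonglongrightarrow> a" using decseq_convergent[OF dec] by blast
  moreover have "measure \<mu> (closure (U \<inter> E)) \<le> a"
    using LIMSEQ_le_const[OF a] measure_closure_le_outer by blast
  ultimately show thesis using that by blast
qed

text \<open>The packing \<open>Q\<close> is copied into each word of \<open>full_words k l U\<close>; since the centres have to be moved into \<open>U\<close>,
  by at most \<open>rmax ^ l\<close> before scaling, the radii are decreased by this amount.\<close>

lemma scattered_packing:
  assumes Q: "Q \<in> finite_packings" and l: "\<And>q. q \<in> Q \<Longrightarrow> rmax ^ l < snd q" and k: "rmax ^ k * c \<le> \<delta>"
  shows "ennreal ((\<Sum>w\<in>full_words k l U. mass w) * (\<Sum>q\<in>Q. (2 * (snd q - rmax ^ l)) powr s))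
    \<le> packing_premeasure_at s \<delta> U"
proof -
  note QD = finite_packingsD[OF Q]
  have "\<exists>v. \<forall>q\<in>Q. v q \<in> W l \<and> fst q \<in> cyl (v q)"
    using E_cyl_cases[of _ l] QD(2) by (intro bchoice) blast
  then obtain v where v: "\<And>q. q \<in> Q \<Longrightarrow> v q \<in> W l \<and> fst q \<in> cyl (v q)" by blast
  \<comment> \<open>Fullness of the word provides a point of \<open>U\<close> in the very
    subcylinder that holds the scaled centre of \<open>q\<close>.\<close>
  have "\<exists>X. \<forall>p\<in>full_words k l U \<times> Q. X p \<in> U \<inter> cyl (fst p @ v (snd p))"
    using v by (intro bchoice) (fastforce simp: full_words_def)
  then obtain X where X: "\<And>w q. w \<in> full_words k l U \<Longrightarrow> q \<in> Q \<Longrightarrow> X (w, q) \<in> U \<inter> cyl (w @ v q)" by force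
  define R where "R p = ratio (fst p) * (snd (snd p) - rmax ^ l)" for p :: "nat list \<times> (real ^ 'n) \<times> real"
  have w: "w \<in> W k" "set w \<subseteq> {1..N}" "0 < ratio w" if "w \<in> full_words k l U" for w
    using that WD ratio_pos by (auto simp: full_words_def)
  have X_cyl: "X (w, q) \<in> cyl w" if "w \<in> full_words k l U" "q \<in> Q" for w q
    using X[OF that] cyl_append_subset[of "v q" w] v[OF that(2)] WD(1) by blast
  have X_near: "dist (X (w, q)) (word_map f w (fst q)) \<le> ratio w * rmax ^ l"
    if wq: "w \<in> full_words k l U" "q \<in> Q" for w q
  proof -
    obtain y where y: "y \<in> cyl (v q)" "X (w, q) = word_map f w y"
      using X[OF wq] by (auto simp: cyl_append)
    have "dist y (fst q) \<le> rmax ^ l" using dist_cyl v[OF wq(2)] y(1) by blast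
    then show ?thesis using y(2) dist_word_map w[OF wq(1)] by simp
  qed
  have "ennreal (\<Sum>p\<in>full_words k l U \<times> Q. (2 * R p) powr s) \<le> packing_premeasure_at s \<delta> U"
  proof (rule finite_family_le_packing_premeasure_at)
    show "finite (full_words k l U \<times> Q)" using QD(1) by (simp add: full_words_def)
    fix p assume p: "p \<in> full_words k l U \<times> Q"
    obtain u q where uq: "p = (u, q)" "u \<in> full_words k l U" "q \<in> Q" using p by blast
    have "ratio u * (snd q - rmax ^ l) \<le> rmax ^ k * (c / 2)"
      using w[OF uq(2)] QD(4)[OF uq(3)] l[OF uq(3)] ratio_le[OF w(1)[OF uq(2)]]
        zero_less_power[OF rmax_pos, of l] zero_less_power[OF rmax_pos, of k]
      by (intro mult_mono) linarith+
    then show "X p \<in> U \<and> 0 < R p \<and> 2 * R p \<le> \<delta>"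
      using uq X[OF uq(2,3)] w[OF uq(2)] l[OF uq(3)] k by (simp add: R_def)
    fix p' assume p': "p' \<in> full_words k l U \<times> Q" "p \<noteq> p'"
    obtain u' q' where uq': "p' = (u', q')" "u' \<in> full_words k l U" "q' \<in> Q" using p' by blast
    show "R p + R p' < dist (X p) (X p')"
    proof (cases "u = u'")
      case True
      then have "snd q + snd q' < dist (fst q) (fst q')" using p'(2) uq uq' QD(5) by auto
      then have "ratio u * (snd q + snd q') < dist (word_map f u (fst q)) (word_map f u (fst q'))"
        using w[OF uq(2)] dist_word_map by simp
      \<comment> \<open>Moving both centres costs at most \<open>2 * ratio u * rmax ^ l\<close>,
        exactly what the two reduced radii give back.\<close>
      also have "\<dots> \<le> dist (X (u, q)) (word_map f u (fst q)) + dist (X (u, q)) (X (u, q'))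
          + dist (X (u, q')) (word_map f u (fst q'))"
        using dist_triangle3[of "word_map f u (fst q)" "word_map f u (fst q')" "X (u, q)"]
          dist_triangle[of "X (u, q)" "word_map f u (fst q')" "X (u, q')"] by linarith
      also have "\<dots> \<le> ratio u * rmax ^ l + dist (X (u, q)) (X (u, q')) + ratio u * rmax ^ l"
        using X_near uq uq' True by (intro add_mono) auto
      finally show ?thesis using True uq uq' by (simp add: R_def algebra_simps)
    next
      case False
      have "snd q - rmax ^ l < c / 2" "snd q' - rmax ^ l < c / 2"
        using QD(4)[OF uq(3)] QD(4)[OF uq'(3)] zero_less_power[OF rmax_pos, of l] by linarith+
      then show ?thesis
        using dist_cyl_gt[OF w(1)[OF uq(2)] w(1)[OF uq'(2)] False X_cyl[OF uq(2,3)] X_cyl[OF uq'(2,3)]]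
          uq uq' by (simp add: R_def)
    qed
  qed
  also have "(\<Sum>p\<in>full_words k l U \<times> Q. (2 * R p) powr s)
    = (\<Sum>w\<in>full_words k l U. \<Sum>q\<in>Q. mass w * (2 * (snd q - rmax ^ l)) powr s)"
    unfolding sum.cartesian_product
  proof (intro sum.cong refl)
    fix p assume "p \<in> full_words k l U \<times> Q"
    then obtain u q where uq: "p = (u, q)" "u \<in> full_words k l U" "q \<in> Q" by blast
    have "2 * R p = ratio u * (2 * (snd q - rmax ^ l))" using uq by (simp add: R_def)
    then show "(2 * R p) powr s = (case p of (w, q) \<Rightarrow> mass w * (2 * (snd q - rmax ^ l)) powr s)"
      using w[OF uq(2)] l[OF uq(3)] uq(1) by (simp add: mass_def powr_mult)
  qed
  also have "\<dots> = (\<Sum>w\<in>full_words k l U. mass w) * (\<Sum>q\<in>Q. (2 * (snd q - rmax ^ l)) powr s)"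
    by (simp add: sum_product)
  finally show ?thesis .
qed

text \<open>Two limits in succession: for fixed \<open>l\<close> the level \<open>k\<close> tends to
  infinity, so that the full words exhaust the limit \<open>a\<close> of the outer masses; then
  \<open>l\<close> tends to infinity and the radii regain their original size.\<close>

lemma packing_premeasure_ge:
  assumes Q: "Q \<in> finite_packings"
  shows "ennreal (measure \<mu> (closure (U \<inter> E)) * packval Q) \<le> packing_premeasure s U"
proof -
  note QD = finite_packingsD[OF Q]
  obtain a where a: "(\<lambda>k. outer_mass k U) \<longlonglongrightarrow> a" "measure \<mu> (closure (U \<inter> E)) \<le> a"
    by (rule outer_convergent)
  let ?v = "\<lambda>l. \<Sum>q\<in>Q. (2 * (snd q - rmax ^ l)) powr s"
  have *: "ennreal (a * ?v l) \<le> packing_premeasure s U" if l: "\<And>q. q \<in> Q \<Longrightarrow> rmax ^ l < snd q" for l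
  proof (rule le_packing_premeasure)
    fix \<delta> :: real assume "\<delta> > 0"
    let ?o = "\<lambda>k. outer_mass k U - (outer_mass k U - outer_mass (k + l) U) / (rmin ^ l) powr s"
    have "?o \<longlonglongrightarrow> a - (a - a) / (rmin ^ l) powr s"
      using rmin_pos by (intro tendsto_intros a(1) LIMSEQ_ignore_initial_segment) auto
    then have "(\<lambda>k. ennreal (?o k * ?v l)) \<longlonglongrightarrow> ennreal (a * ?v l)"
      by (intro tendsto_ennrealI tendsto_mult_right) simp
    moreover have "\<forall>\<^sub>F k in sequentially. ennreal (?o k * ?v l) \<le> packing_premeasure_at s \<delta> U"
    proof -
      have "(\<lambda>k. rmax ^ k * c) \<longlonglongrightarrow> 0 * c" by (intro tendsto_mult_right rmax_power_tendsto)
      then have "\<forall>\<^sub>F k in sequentially. rmax ^ k * c < \<delta>" using \<open>\<delta> > 0\<close> by (auto dest: order_tendstoD)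
      then show ?thesis
      proof eventually_elim
        case (elim k)
        have "ennreal (?o k * ?v l) \<le> ennreal ((\<Sum>w\<in>full_words k l U. mass w) * ?v l)"
          by (intro ennreal_leI mult_right_mono outer_le_full sum_nonneg) auto
        also have "\<dots> \<le> packing_premeasure_at s \<delta> U"
          using elim by (intro scattered_packing[OF Q l]) auto
        finally show ?case .
      qed
    qed
    ultimately show "ennreal (a * ?v l) \<le> packing_premeasure_at s \<delta> U"
      by (intro tendsto_upperbound[OF _ _ sequentially_bot])
  qed
  have "(\<lambda>l. ennreal (a * ?v l)) \<longlonglongrightarrow> ennreal (a * (\<Sum>q\<in>Q. (2 * (snd q - 0)) powr s))"
    by (intro tendsto_ennrealI tendsto_intros rmax_power_tendsto) (use QD(3) in fastforce)+
  moreover have "\<forall>\<^sub>F l in sequentially. \<forall>q\<in>Q. rmax ^ l < snd q"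
    using QD(1,3) order_tendstoD(2)[OF rmax_power_tendsto] by (intro eventually_ball_finite) auto
  then have "\<forall>\<^sub>F l in sequentially. ennreal (a * ?v l) \<le> packing_premeasure s U"
    by eventually_elim (use * in blast)
  ultimately have "ennreal (a * packval Q) \<le> packing_premeasure s U"
    unfolding packval_def by (intro tendsto_upperbound[OF _ _ sequentially_bot]) simp_all
  moreover have "ennreal (measure \<mu> (closure (U \<inter> E)) * packval Q) \<le> ennreal (a * packval Q)"
    using a(2) packval_nonneg by (intro ennreal_leI mult_right_mono)
  ultimately show ?thesis by (rule order_trans[rotated])
qed

text \<open>The sets of a cover may be nonmeasurable, so the closures of their traces on
  \<open>E\<close> are used. These still cover \<open>E\<close>, and countable subadditivity gives
  total mass at least 1.\<close>

lemma packval_le_packing_measure: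
  assumes Q: "Q \<in> finite_packings" shows "ennreal (packval Q) \<le> packing_measure s E"
  unfolding packing_measure_def
proof (rule Inf_greatest, clarify)
  fix U :: "nat \<Rightarrow> (real ^ 'n) set" assume U: "E \<subseteq> (\<Union>i. U i)"
  let ?C = "\<lambda>i. closure (U i \<inter> E)"
  have sets: "?C i \<in> sets \<mu>" for i by (simp add: sets_closed)
  have "U i \<inter> E \<subseteq> ?C i" for i by (rule closure_subset)
  then have "(\<Union>i. U i \<inter> E) \<subseteq> (\<Union>i. ?C i)" by (rule UN_mono[OF order_refl])
  moreover have "E \<subseteq> (\<Union>i. U i \<inter> E)" using U by blast
  ultimately have "E \<subseteq> (\<Union>i. ?C i)" by (rule order_trans[rotated])
  then have "emeasure \<mu> E \<le> emeasure \<mu> (\<Union>i. ?C i)"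
    using sets by (intro emeasure_mono) auto
  also have "\<dots> \<le> (\<Sum>i. emeasure \<mu> (?C i))"
    using sets by (intro emeasure_subadditive_countably) auto
  finally have "1 \<le> (\<Sum>i. emeasure \<mu> (?C i))"
    using measure_E by (simp add: mu.emeasure_eq_measure)
  then have "ennreal (packval Q) * 1 \<le> ennreal (packval Q) * (\<Sum>i. emeasure \<mu> (?C i))"
    by (rule mult_left_mono) simp
  also have "\<dots> = (\<Sum>i. ennreal (packval Q) * emeasure \<mu> (?C i))"
    by simp
  also have "\<dots> \<le> (\<Sum>i. packing_premeasure s (U i))"
  proof (intro suminf_le allI)
    show "ennreal (packval Q) * emeasure \<mu> (?C i) \<le> packing_premeasure s (U i)" for i
      using packing_premeasure_ge[OF Q, of "U i"] packval_nonneg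
      by (simp add: mu.emeasure_eq_measure ennreal_mult mult.commute)
  qed auto
  finally show "ennreal (packval Q) \<le> (\<Sum>i. packing_premeasure s (U i))" by simp
qed

lemma packing_measure_eq: "packing_measure s E = ennreal hsup"
proof (rule antisym[OF packing_measure_le_hsup])
  have "ennreal hsup \<le> ennreal vsup" using hsup_le_vsup by (rule ennreal_leI)
  also have "\<dots> \<le> packing_measure s E"
  proof (cases "packing_measure s E")
    \<comment> \<open>Only a finite packing measure needs an argument; \<open>vsup\<close> is a real
      supremum, so the bound is transferred to the reals first.\<close>
    case (real t)
    have "packval Q \<le> t" if "Q \<in> finite_packings" for Q
      using packval_le_packing_measure[OF that] real by (simp add: ennreal_le_iff)
    then have "vsup \<le> t" unfolding vsup_def using empty_finite_packing by (intro cSUP_least) auto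
    then show ?thesis using real by (simp add: ennreal_leI)
  qed simp
  finally show "ennreal hsup \<le> packing_measure s E" .
qed

section \<open>Convergence of the discrete maxima\<close>

lemma finite_D_dists: "finite (D_dists N f r c k)"
proof -
  have "D_dists N f r c k \<subseteq> (\<lambda>(x, y). dist x y) ` (A_pts N f k \<times> A_pts N f k)"
    by (auto simp: D_dists_def)
  then show ?thesis using finite_A_pts finite_subset by blast
qed

lemma measure_mu_disc_pos:
  assumes "x \<in> A_pts N f (Suc k)" "0 < d"
  shows "0 < measure (mu_disc N f r s (Suc k)) (ball x d)"
proof -
  obtain w where w: "w \<in> W (Suc k)" "x = pt w" using assms(1) unfolding A_pts_eq by blast
  have "(\<Sum>v\<in>{w}. mass v) \<le> (\<Sum>v\<in>{v\<in>W (Suc k). pt v \<in> ball x d}. mass v)"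
    using w assms(2) by (intro sum_mono2) (auto simp: mass_def)
  then show ?thesis using mass_pos[OF WD(1)[OF w(1)]] unfolding measure_mu_disc by simp
qed

lemma m_tilde_ge:
  assumes "x \<in> A_pts N f k" "d \<in> D_dists N f r c k"
  shows "h_disc N f r s k x d \<le> m_tilde N f r s c k"
proof -
  have "h_disc N f r s k x d \<in> (\<lambda>(x, d). h_disc N f r s k x d) ` (A_pts N f k \<times> D_dists N f r c k)"
    using assms by force
  then show ?thesis
    using assms(2) finite_A_pts finite_D_dists unfolding m_tilde_def by (auto intro!: Max_ge)
qed

text \<open>Compare with the natural measure of the ball of radius reduced by
  \<open>rmax ^ Suc k\<close>. As radii in \<open>D_dists\<close> are at least \<open>c\<close>, the
  relative loss of radius is largest at \<open>c\<close>, which gives the factor.\<close>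

lemma m_tilde_le:
  assumes "rmax ^ Suc k < c"
  shows "m_tilde N f r s c (Suc k) \<le> (c / (c - rmax ^ Suc k)) powr s * hsup"
proof -
  let ?\<eta> = "rmax ^ Suc k" and ?A = "A_pts N f (Suc k)" and ?D = "D_dists N f r c (Suc k)"
  let ?K = "(c / (c - ?\<eta>)) powr s"
  have le: "h_disc N f r s (Suc k) x d \<le> ?K * hsup" if x: "x \<in> ?A" and d: "d \<in> ?D" for x d
  proof -
    let ?m = "measure (mu_disc N f r s (Suc k)) (ball x d)"
    have cd: "c \<le> d" "d \<le> c / rmin" using d by (auto simp: D_dists_def)
    have \<eta>: "0 < ?\<eta>" using rmax_pos by simp
    have xE: "x \<in> E" using x A_pts_subset_E by blast
    have "(2 * (d - ?\<eta>)) powr s \<le> hsup * measure \<mu> (ball x (d - ?\<eta>))"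
      using cd assms \<eta> xE by (intro powr_le_hsup) linarith+
    also have "\<dots> \<le> hsup * ?m"
      using measure_mu_disc_ge[of x "d - ?\<eta>" k] hsup_pos by (intro mult_left_mono) simp_all
    finally have 1: "(2 * (d - ?\<eta>)) powr s \<le> hsup * ?m" .
    have "d * (c - ?\<eta>) \<le> c * (d - ?\<eta>)"
      using mult_right_mono[OF cd(1), of ?\<eta>] \<eta> by (simp add: algebra_simps)
    then have "2 * d \<le> c / (c - ?\<eta>) * (2 * (d - ?\<eta>))"
      using assms by (simp add: field_simps)
    then have "(2 * d) powr s \<le> (c / (c - ?\<eta>) * (2 * (d - ?\<eta>))) powr s"
      using cd c_pos s_pos by (intro powr_mono2) auto
    also have "\<dots> = ?K * (2 * (d - ?\<eta>)) powr s"
      using assms cd c_pos by (intro powr_mult)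
    also have "\<dots> \<le> ?K * (hsup * ?m)" using 1 by (intro mult_left_mono) auto
    finally show ?thesis
      unfolding h_disc_def using measure_mu_disc_pos[OF x, of d] cd c_pos
      by (simp add: divide_le_eq mult.assoc)
  qed
  show ?thesis
  proof (cases "?D = {}")
    case True
    then show ?thesis using hsup_pos by (simp add: m_tilde_def)
  next
    case False
    then have "?A \<noteq> {}" by (auto simp: D_dists_def)
    then show ?thesis
      using False le finite_A_pts[of "Suc k"] finite_D_dists[of "Suc k"]
      by (auto simp: m_tilde_def simp del: A_pts.simps)
  qed
qed

section \<open>Lower bound for the discrete maxima\<close>

lemma measure_mu_disc_le_if_no_point:
  assumes "\<And>z. z \<in> A_pts N f (Suc k) \<Longrightarrow> a \<le> dist y z \<Longrightarrow> b \<le> dist y z"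
  shows "measure (mu_disc N f r s (Suc k)) (ball y b) \<le> measure (mu_disc N f r s (Suc k)) (ball y a)"
  unfolding measure_mu_disc
proof (rule sum_mono2)
  show "{w \<in> W (Suc k). pt w \<in> ball y b} \<subseteq> {w \<in> W (Suc k). pt w \<in> ball y a}"
    using assms unfolding A_pts_eq by (auto simp: not_less[symmetric])
qed (auto simp: mass_def)

text \<open>Take a point nearest to \<open>y\<close> among those at distance at least
  \<open>a\<close>. The radius becomes an attained distance without any gain of discrete
  mass.\<close>

lemma next_distance:
  assumes "z \<in> A_pts N f (Suc k)" "a \<le> dist y z"
  obtains z' where "z' \<in> A_pts N f (Suc k)" "a \<le> dist y z'" "dist y z' \<le> dist y z"
    "measure (mu_disc N f r s (Suc k)) (ball y (dist y z')) \<le> measure (mu_disc N f r s (Suc k)) (ball y a)"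
proof -
  let ?S = "{z \<in> A_pts N f (Suc k). a \<le> dist y z}"
  have S: "finite ?S" "?S \<noteq> {}" using assms finite_A_pts[of "Suc k"] by auto
  obtain z' where z': "z' \<in> ?S" "\<And>z. z \<in> ?S \<Longrightarrow> dist y z' \<le> dist y z"
    using arg_min_if_finite[OF S, of "dist y"] by (metis (no_types, lifting) not_less)
  show thesis
    using that[of z'] z' assms measure_mu_disc_le_if_no_point[of k a y "dist y z'"] by blast
qed

text \<open>With \<open>i\<close> of minimal ratio, \<open>(x, d)\<close> is discretised either near \<open>(f i x, rmin * d)\<close> or near
  \<open>(x, d)\<close> itself. Distances found in the first attempt that are smaller than \<open>c\<close> are blown up by
  the inverse of \<open>f i\<close> to distances below \<open>c / rmin\<close>, which is possible at the same level \<open>k\<close> since the sets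
  \<open>A_pts N f k\<close> increase with \<open>k\<close>.\<close>

lemma h_disc_near_optimal:
  fixes l :: nat
  defines "k \<equiv> Suc (Suc l)" and "\<eta> \<equiv> rmax ^ Suc (Suc l)"
  assumes x: "x \<in> E" and d: "d \<le> c / rmin" and \<delta>: "\<delta> = d - 2 * \<eta> / rmin" "c < \<delta>"
    and \<eta>: "\<eta> < c / rmin" and opt: "hsup < h x d * ((c / rmin - \<eta>) / c) powr s"
  shows "\<exists>x'\<in>A_pts N f k. \<exists>e\<in>D_dists N f r c k. (2 * \<delta>) powr s / measure \<mu> (ball x d) \<le> h_disc N f r s k x' e"
proof -
  let ?\<mu> = "mu_disc N f r s k" and ?b = "measure \<mu> (ball x d)"
  have \<eta>_pos: "0 < \<eta>" using rmax_pos by (simp add: \<eta>_def)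
  then have \<eta>_le: "\<eta> \<le> \<eta> / rmin" using rmin_pos rmin_less_1 by (simp add: le_divide_eq)
  have d_pos: "0 < d" using \<delta> c_pos \<eta>_pos rmin_pos by (smt (verit) divide_pos_pos)
  have b: "0 < ?b" using measure_ball_pos[OF x d_pos] .
  obtain i where i: "i \<in> {1..N}" "r i = rmin" by (rule rmin_attained)
  have rd: "rmin * d \<le> c" using d rmin_pos by (simp add: le_divide_eq mult.commute)
  obtain w where w: "w \<in> W (Suc l)" "x \<in> cyl w" using E_cyl_cases[OF x] by blast
  have iw: "i # w \<in> W k" using w i by (simp add: k_def)
  have nonempty: "v \<noteq> []" if "v \<in> W (Suc l)" for v using WD(2)[OF that] by auto
  have pt_iw: "pt (i # w) = f i (pt w)" using nonempty[OF w(1)] by (rule pt_Cons)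
  have x'_A: "pt w \<in> A_pts N f k"
    using A_pts_mono[of "Suc l"] w(1) unfolding k_def A_pts_eq by blast
  have z'_A: "f i (pt w) \<in> A_pts N f k"
    using iw unfolding k_def A_pts_eq pt_iw[symmetric] by (rule imageI)
  have "f i x \<in> cyl (i # w)" "f i (pt w) \<in> cyl (i # w)"
    using w pt_in_cyl[OF w(1)] by (auto simp: cyl_Cons)
  then have dz: "dist (f i x) (f i (pt w)) \<le> \<eta>"
    using dist_cyl[OF iw] by (simp add: \<eta>_def k_def)
  then have dx: "dist x (pt w) \<le> \<eta> / rmin"
    using dist_f[OF i(1)] i(2) rmin_pos by (simp add: le_divide_eq mult.commute)
  have pos: "0 < measure ?\<mu> (ball y e)" if "y \<in> A_pts N f k" "0 < e" for y e
    using that unfolding k_def by (rule measure_mu_disc_pos)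
  \<comment> \<open>Of the margin \<open>2 * \<eta> / rmin\<close>, one half pays for moving the
    centre from \<open>x\<close> to \<open>pt w\<close>, the other for replacing the discrete
    measure.\<close>
  have ball_x: "measure ?\<mu> (ball (pt w) \<delta>) \<le> ?b"
  proof -
    have "measure ?\<mu> (ball (pt w) \<delta>) \<le> measure \<mu> (ball (pt w) (\<delta> + \<eta>))"
      unfolding k_def \<eta>_def by (rule measure_mu_disc_le)
    also have "\<dots> \<le> ?b"
    proof (rule mu.finite_measure_mono)
      show "ball (pt w) (\<delta> + \<eta>) \<subseteq> ball x d"
      proof
        fix u assume "u \<in> ball (pt w) (\<delta> + \<eta>)"
        then show "u \<in> ball x d" using dx \<eta>_le \<delta>(1) dist_triangle[of x u "pt w"] by simp
      qed
    qed (simp add: sets_open)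
    finally show ?thesis .
  qed
  have ball_z: "measure ?\<mu> (ball (f i (pt w)) (rmin * \<delta>)) \<le> rmin powr s * ?b"
  proof -
    have "measure ?\<mu> (ball (f i (pt w)) (rmin * \<delta>)) \<le> measure \<mu> (ball (f i (pt w)) (rmin * \<delta> + \<eta>))"
      unfolding k_def \<eta>_def by (rule measure_mu_disc_le)
    also have "\<dots> \<le> measure \<mu> (ball (f i x) (rmin * d))"
    proof (rule mu.finite_measure_mono)
      \<comment> \<open>After scaling by \<open>rmin\<close> the margin is exactly
        \<open>2 * \<eta>\<close>: again one \<open>\<eta>\<close> for the centre and one for the
        discretisation.\<close>
      have eq: "rmin * \<delta> + 2 * \<eta> = rmin * d" using \<delta>(1) rmin_pos by (simp add: field_simps)
      show "ball (f i (pt w)) (rmin * \<delta> + \<eta>) \<subseteq> ball (f i x) (rmin * d)"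
      proof (intro subsetI)
        fix u assume "u \<in> ball (f i (pt w)) (rmin * \<delta> + \<eta>)"
        then show "u \<in> ball (f i x) (rmin * d)"
          using dz eq dist_triangle[of "f i x" u "f i (pt w)"] by simp
      qed
    qed (simp add: sets_open)
    also have "\<dots> = rmin powr s * ?b"
      using measure_ball_scale[OF i(1) x, of d] i(2) rd by simp
    finally show ?thesis .
  qed
  \<comment> \<open>Without such a point the ball could grow to radius \<open>c / rmin\<close> at no
    cost in discrete mass; \<open>opt\<close> and the bound by \<open>hsup\<close> then contradict
    each other.\<close>
  have "\<exists>z\<in>A_pts N f k. rmin * \<delta> \<le> dist (f i (pt w)) z \<and> dist (f i (pt w)) z \<le> c / rmin"
  proof (rule ccontr)
    assume "\<not> ?thesis"
    then have no: "\<And>z. z \<in> A_pts N f k \<Longrightarrow> rmin * \<delta> \<le> dist (f i (pt w)) z \<Longrightarrow> c / rmin \<le> dist (f i (pt w)) z"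
      by force
    have "measure \<mu> (ball (f i (pt w)) (c / rmin - \<eta>)) \<le> measure ?\<mu> (ball (f i (pt w)) (c / rmin))"
      using measure_mu_disc_ge[of "f i (pt w)" "c / rmin - \<eta>" "Suc l"] by (simp add: k_def \<eta>_def)
    also have "\<dots> \<le> measure ?\<mu> (ball (f i (pt w)) (rmin * \<delta>))"
      using no unfolding k_def by (rule measure_mu_disc_le_if_no_point)
    finally have le: "measure \<mu> (ball (f i (pt w)) (c / rmin - \<eta>)) \<le> rmin powr s * ?b"
      using ball_z by linarith
    have "(2 * (c / rmin - \<eta>)) powr s \<le> hsup * measure \<mu> (ball (f i (pt w)) (c / rmin - \<eta>))"
      using \<eta> \<eta>_pos z'_A A_pts_subset_E by (intro powr_le_hsup) auto
    also have "\<dots> \<le> hsup * (rmin powr s * ?b)"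
      using le hsup_pos by (intro mult_left_mono) auto
    also have "\<dots> < h x d * ((c / rmin - \<eta>) / c) powr s * (rmin powr s * ?b)"
      using opt b rmin_pos by (intro mult_strict_right_mono) auto
    also have "\<dots> = (2 * d) powr s * ((c / rmin - \<eta>) / c) powr s * rmin powr s"
      using b by (simp add: h_def)
    also have "\<dots> = (2 * d * ((c / rmin - \<eta>) / c) * rmin) powr s"
    proof -
      have "(2 * d) powr s * g powr s * rmin powr s = (2 * d * g * rmin) powr s" if "0 < g" for g
        using that d_pos rmin_pos by (simp add: powr_mult)
      then show ?thesis using \<eta> c_pos by simp
    qed
    also have "\<dots> \<le> (2 * (c / rmin - \<eta>)) powr s"
    proof (rule powr_mono2)
      have "2 * d * ((c / rmin - \<eta>) / c) * rmin = rmin * d / c * (2 * (c / rmin - \<eta>))" by simp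
      also have "\<dots> \<le> 1 * (2 * (c / rmin - \<eta>))"
        using rd c_pos \<eta> by (intro mult_right_mono) auto
      finally show "2 * d * ((c / rmin - \<eta>) / c) * rmin \<le> 2 * (c / rmin - \<eta>)" by simp
    qed (use s_pos d_pos \<eta> c_pos rmin_pos in auto)
    finally show False by simp
  qed
  then obtain z0 where z0: "z0 \<in> A_pts N f k" "rmin * \<delta> \<le> dist (f i (pt w)) z0"
      "dist (f i (pt w)) z0 \<le> c / rmin" by blast
  obtain z where z: "z \<in> A_pts N f k" "rmin * \<delta> \<le> dist (f i (pt w)) z"
      "dist (f i (pt w)) z \<le> dist (f i (pt w)) z0"
      "measure ?\<mu> (ball (f i (pt w)) (dist (f i (pt w)) z)) \<le> measure ?\<mu> (ball (f i (pt w)) (rmin * \<delta>))"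
    using next_distance[of z0 "Suc l" "rmin * \<delta>" "f i (pt w)"] z0 unfolding k_def by blast
  show ?thesis
  proof (cases "c \<le> dist (f i (pt w)) z")
    case True
    let ?e = "dist (f i (pt w)) z"
    have eD: "?e \<in> D_dists N f r c k"
      using True order_trans[OF z(3) z0(3)] z(1) z'_A unfolding D_dists_def by blast
    have "(2 * \<delta>) powr s / ?b = (2 * (rmin * \<delta>)) powr s / (rmin powr s * ?b)"
      using rmin_pos \<delta>(2) c_pos by (simp add: powr_mult)
    also have "\<dots> \<le> h_disc N f r s k (f i (pt w)) ?e"
      unfolding h_disc_def
    proof (rule frac_le)
      show "(2 * (rmin * \<delta>)) powr s \<le> (2 * ?e) powr s"
        using z(2) s_pos rmin_pos \<delta>(2) c_pos by (intro powr_mono2) auto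
      show "0 < measure ?\<mu> (ball (f i (pt w)) ?e)"
        using pos[OF z'_A, of ?e] True c_pos by linarith
    qed (use z(4) ball_z in auto)
    finally show ?thesis using eD z'_A by blast
  next
    \<comment> \<open>At distance below \<open>c\<close> both points lie in the same first level
      piece, so \<open>f i\<close> can be undone on both.\<close>
    case False
    obtain v' where v': "v' \<in> W k" "z = pt v'" using z(1) unfolding k_def A_pts_eq by blast
    obtain j v where jv: "v' = j # v" "j \<in> {1..N}" "v \<in> W (Suc l)"
      using v'(1) unfolding k_def by (rule W_Suc_cases)
    have zj: "z = f j (pt v)" using v'(2) jv(1) pt_Cons[OF nonempty[OF jv(3)]] by simp
    have "i = j"
      using gap[OF i(1) jv(2) _ imageI imageI, OF _ pt_in_E[OF w(1)] pt_in_E[OF jv(3)]] False zj by blast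
    then have dist_z: "dist (f i (pt w)) z = rmin * dist (pt w) (pt v)"
      using zj dist_f[OF i(1)] i(2) by simp
    have v_A: "pt v \<in> A_pts N f k"
      using A_pts_mono[of "Suc l"] jv(3) unfolding k_def A_pts_eq by blast
    have \<delta>_le: "\<delta> \<le> dist (pt w) (pt v)" using z(2) dist_z rmin_pos by simp
    \<comment> \<open>\<open>pt v\<close> only shows that a distance of at least
      \<open>\<delta>\<close> occurs; the nearest such point keeps the mass bound
      \<open>ball_x\<close>.\<close>
    obtain u where u: "u \<in> A_pts N f k" "\<delta> \<le> dist (pt w) u" "dist (pt w) u \<le> dist (pt w) (pt v)"
        "measure ?\<mu> (ball (pt w) (dist (pt w) u)) \<le> measure ?\<mu> (ball (pt w) \<delta>)"
      using next_distance[of "pt v" "Suc l" \<delta> "pt w"] v_A \<delta>_le unfolding k_def by blast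
    let ?e = "dist (pt w) u"
    have "rmin * dist (pt w) (pt v) \<le> c" using False dist_z by simp
    then have "dist (pt w) (pt v) \<le> c / rmin" using rmin_pos by (simp add: le_divide_eq mult.commute)
    then have "?e \<le> c / rmin" using u(3) by linarith
    then have eD: "?e \<in> D_dists N f r c k"
      using u(1) order_trans[OF less_imp_le[OF \<delta>(2)] u(2)] x'_A unfolding D_dists_def by blast
    have "(2 * \<delta>) powr s / ?b \<le> h_disc N f r s k (pt w) ?e"
      unfolding h_disc_def
    proof (rule frac_le)
      show "(2 * \<delta>) powr s \<le> (2 * ?e) powr s"
        using u(2) s_pos \<delta>(2) c_pos by (intro powr_mono2) auto
      show "0 < measure ?\<mu> (ball (pt w) ?e)"
        using pos[OF x'_A, of ?e] u(2) \<delta>(2) c_pos by linarith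
    qed (use u(4) ball_x in auto)
    then show ?thesis using eD x'_A by blast
  qed
qed

lemma eventually_m_tilde_greater:
  assumes "t < hsup"
  shows "\<forall>\<^sub>F k in sequentially. t < m_tilde N f r s c k"
proof -
  have "rmin powr s < 1" using rmin_pos rmin_less_1 s_pos powr_less_mono2[of s rmin 1] by simp
  \<comment> \<open>The second entry of the maximum secures the hypothesis \<open>opt\<close> in the
    limit, where its power factor tends to \<open>1 / rmin powr s\<close>.\<close>
  then have "max t (hsup * rmin powr s) < hsup" using assms hsup_pos by simp
  then obtain x d where xd: "x \<in> E" "c < d" "d \<le> c / rmin" "max t (hsup * rmin powr s) < h x d"
    by (rule ex_h_greater)
  let ?\<eta> = "\<lambda>l. rmax ^ Suc (Suc l)" and ?b = "measure \<mu> (ball x d)"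
  let ?\<delta> = "\<lambda>l. d - 2 * ?\<eta> l / rmin"
  have \<eta>: "?\<eta> \<longlonglongrightarrow> 0" using LIMSEQ_Suc[OF LIMSEQ_Suc[OF rmax_power_tendsto]] .
  have \<delta>: "?\<delta> \<longlonglongrightarrow> d - 2 * 0 / rmin" by (intro tendsto_intros \<eta>) (use rmin_pos in auto)
  have b: "0 < ?b" using measure_ball_pos[OF xd(1)] xd(2) c_pos by simp
  have 1: "\<forall>\<^sub>F l in sequentially. c < ?\<delta> l" using order_tendstoD(1)[OF \<delta>] xd(2) by simp
  have 2: "\<forall>\<^sub>F l in sequentially. ?\<eta> l < c / rmin"
    using order_tendstoD(2)[OF \<eta>] c_pos rmin_pos by simp
  have "(\<lambda>l. h x d * ((c / rmin - ?\<eta> l) / c) powr s) \<longlonglongrightarrow> h x d * ((c / rmin - 0) / c) powr s"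
    by (intro tendsto_intros \<eta>) (use c_pos rmin_pos in auto)
  moreover have "hsup < h x d * ((c / rmin - 0) / c) powr s"
    using xd(4) c_pos rmin_pos by (simp add: powr_divide less_divide_eq)
  ultimately have 3: "\<forall>\<^sub>F l in sequentially. hsup < h x d * ((c / rmin - ?\<eta> l) / c) powr s"
    by (rule order_tendstoD(1))
  have "(\<lambda>l. (2 * ?\<delta> l) powr s / ?b) \<longlonglongrightarrow> (2 * (d - 2 * 0 / rmin)) powr s / ?b"
    by (intro tendsto_intros \<delta>) (use b xd(2) c_pos in auto)
  moreover have "t < (2 * (d - 2 * 0 / rmin)) powr s / ?b" using xd(4) by (simp add: h_def)
  ultimately have 4: "\<forall>\<^sub>F l in sequentially. t < (2 * ?\<delta> l) powr s / ?b"
    by (rule order_tendstoD(1))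
  have "\<forall>\<^sub>F l in sequentially. t < m_tilde N f r s c (Suc (Suc l))"
    using 1 2 3 4
  proof eventually_elim
    case (elim l)
    then obtain x' e where "x' \<in> A_pts N f (Suc (Suc l))" "e \<in> D_dists N f r c (Suc (Suc l))"
        "(2 * ?\<delta> l) powr s / ?b \<le> h_disc N f r s (Suc (Suc l)) x' e"
      using h_disc_near_optimal[OF xd(1,3) refl, of l] by blast
    then show ?case using m_tilde_ge[of x' "Suc (Suc l)" e] elim(4) by linarith
  qed
  then show ?thesis
    unfolding eventually_sequentially_Suc[of "\<lambda>k. t < m_tilde N f r s c k"]
      eventually_sequentially_Suc[of "\<lambda>k. t < m_tilde N f r s c (Suc k)"] .
qed

lemma eventually_m_tilde_less:
  assumes "hsup < t"
  shows "\<forall>\<^sub>F k in sequentially. m_tilde N f r s c k < t"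
proof -
  have \<eta>: "(\<lambda>k. rmax ^ Suc k) \<longlonglongrightarrow> 0" using LIMSEQ_Suc[OF rmax_power_tendsto] .
  have "(\<lambda>k. (c / (c - rmax ^ Suc k)) powr s * hsup) \<longlonglongrightarrow> (c / (c - 0)) powr s * hsup"
    by (intro tendsto_intros \<eta>) (use c_pos in auto)
  then have 1: "\<forall>\<^sub>F k in sequentially. (c / (c - rmax ^ Suc k)) powr s * hsup < t"
    by (rule order_tendstoD(2)) (use assms c_pos in simp)
  have 2: "\<forall>\<^sub>F k in sequentially. rmax ^ Suc k < c" using order_tendstoD(2)[OF \<eta>] c_pos by simp
  have "\<forall>\<^sub>F k in sequentially. m_tilde N f r s c (Suc k) < t"
    using 1 2 by eventually_elim (use m_tilde_le in fastforce)
  then show ?thesis unfolding eventually_sequentially_Suc[of "\<lambda>k. m_tilde N f r s c k < t"] .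
qed

lemma m_tilde_tendsto: "m_tilde N f r s c \<longlonglongrightarrow> hsup"
  by (intro order_tendstoI eventually_m_tilde_greater eventually_m_tilde_less)

text \<open>The closed ball has at least the mass of the open one, so under the equality of masses
  \<open>h_disc\<close> is at most \<open>h\<close>.\<close>

lemma h_disc_le_hsup:
  assumes "x \<in> A_pts N f k" "d \<in> D_dists N f r c k"
    and "measure (mu_disc N f r s k) (ball x d) = measure \<mu> (cball x d)"
  shows "h_disc N f r s k x d \<le> hsup"
proof -
  have x: "x \<in> E" using assms(1) A_pts_subset_E by blast
  have d: "0 < d" "d \<le> c / rmin" using assms(2) c_pos by (auto simp: D_dists_def)
  have "measure \<mu> (ball x d) \<le> measure \<mu> (cball x d)"
    by (intro mu.finite_measure_mono) (auto simp: sets_closed)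
  then have "h_disc N f r s k x d \<le> h x d"
    unfolding h_disc_def h_def assms(3) using measure_ball_pos[OF x d(1)]
    by (intro divide_left_mono) auto
  also have "\<dots> \<le> hsup" using x d by (rule h_le_hsup)
  finally show ?thesis .
qed

end

theorem theorem15:
  fixes N :: nat
    and f :: "nat \<Rightarrow> real ^ 'n \<Rightarrow> real ^ 'n"
    and r :: "nat \<Rightarrow> real"
    and s c :: real
    and E :: "(real ^ 'n) set"
    and \<mu> :: "(real ^ 'n) measure"
    and k0 :: nat
  assumes "N \<ge> 2"
    and "similitudes N f r"
    and "self_similar_set N f E"
    and "strong_separation N f E"
    and "diameter E = 1"
    and "similarity_dimension N r s"
    and "natural_measure N f r s E \<mu>"
    and "k0 \<ge> 1"
    and "c = c_tilde N f r k0"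
    and "c > 0"
  shows "(\<lambda>k. ennreal (m_tilde N f r s c k)) \<longlonglongrightarrow> packing_measure s E
    \<and> (\<forall>k\<ge>1. D_dists N f r c k \<noteq> {} \<longrightarrow>
        (\<forall>x\<in>A_pts N f k. \<forall>d\<in>D_dists N f r c k.
          m_tilde N f r s c k = h_disc N f r s k x d \<longrightarrow>
          measure (mu_disc N f r s k) (ball x d) = measure \<mu> (cball x d) \<longrightarrow>
          packing_measure s E \<ge> ennreal (m_tilde N f r s c k)))"
proof -
  interpret self_similar_system N f r s E \<mu>
    using assms by unfold_locales
  \<comment> \<open>The separation hypothesis holds for \<open>c\<close> by
    \<open>c_tilde_le_dist\<close> at level \<open>k0\<close>.\<close>
  interpret separated_system N f r s E \<mu> c
    using assms c_tilde_le_dist by unfold_locales blast+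
  show ?thesis
    unfolding packing_measure_eq
    using tendsto_ennrealI[OF m_tilde_tendsto] h_disc_le_hsup by (auto intro: ennreal_leI)
qed

end
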